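(* There exists a Noetherian commutative domain $\Lambda$ of Krull dimension $1$ such that for every $n\ge 2$, there exists a matrix in $\mathrm{M}_n(\Lambda)$ of trace $0$ that is not a commutator.
   Context: $\mathrm{M}_n(\Lambda)$ is the ring of $n\times n$ matrices over $\Lambda$. A matrix $C\in \mathrm{M}_n(\Lambda)$ is a commutator if there exist $A,B\in \mathrm{M}_n(\Lambda)$ with $C=[A,B]:=AB-BA$. *)

theory Defs
  imports
    "HOL-Library.Extended_Nat"
    "HOL-Library.Poly_Mapping"
    "HOL-Computational_Algebra.Fraction_Field"
    "HOL-Algebra.Algebra"
begin

section \<open>Krull dimension\<close>

definition prime_chain :: "('a, 'b) ring_scheme \<Rightarrow> nat \<Rightarrow> (nat \<Rightarrow> 'a set) \<Rightarrow> bool" where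
  "prime_chain R d P \<longleftrightarrow>
     (\<forall>i\<le>d. primeideal (P i) R) \<and> (\<forall>i<d. P i \<subset> P (Suc i))"

text \<open>A chain \<open>P 0 \<subset> \<dots> \<subset> P d\<close> has length \<open>d\<close>. The supremum is \<open>\<infinity>\<close> if the lengths are
  unbounded; the zero ring, which has no prime ideals, gets dimension \<open>0\<close>.\<close>

definition krull_dim :: "('a, 'b) ring_scheme \<Rightarrow> enat" where
  "krull_dim R = Sup {enat d | d. \<exists>P. prime_chain R d P}"


section \<open>The ring of square matrices over a ring\<close>

text \<open>Entries are indexed by pairs \<open>(i, j)\<close> with \<open>i, j < n\<close>. Matrices are extensional, that is
  \<open>undefined\<close> outside this index set, so that two matrices are equal iff their entries are.\<close>

definition matrix_ring :: "('a, 'b) ring_scheme \<Rightarrow> nat \<Rightarrow> (nat \<times> nat \<Rightarrow> 'a) ring" where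
  "matrix_ring R n =
    \<lparr> carrier = {..<n} \<times> {..<n} \<rightarrow>\<^sub>E carrier R,
      monoid.mult = (\<lambda>A B. \<lambda>(i, j)\<in>{..<n} \<times> {..<n}. \<Oplus>\<^bsub>R\<^esub>k\<in>{..<n}. A (i, k) \<otimes>\<^bsub>R\<^esub> B (k, j)),
      monoid.one = (\<lambda>(i, j)\<in>{..<n} \<times> {..<n}. if i = j then \<one>\<^bsub>R\<^esub> else \<zero>\<^bsub>R\<^esub>),
      ring.zero = (\<lambda>_\<in>{..<n} \<times> {..<n}. \<zero>\<^bsub>R\<^esub>),
      ring.add = (\<lambda>A B. \<lambda>ij\<in>{..<n} \<times> {..<n}. A ij \<oplus>\<^bsub>R\<^esub> B ij) \<rparr>"

definition matrix_trace :: "('a, 'b) ring_scheme \<Rightarrow> nat \<Rightarrow> (nat \<times> nat \<Rightarrow> 'a) \<Rightarrow> 'a" where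
  "matrix_trace R n A = (\<Oplus>\<^bsub>R\<^esub>i\<in>{..<n}. A (i, i))"

definition is_commutator :: "('a, 'b) ring_scheme \<Rightarrow> 'a \<Rightarrow> bool" where
  "is_commutator M C \<longleftrightarrow>
     (\<exists>A\<in>carrier M. \<exists>B\<in>carrier M. C = A \<otimes>\<^bsub>M\<^esub> B \<ominus>\<^bsub>M\<^esub> B \<otimes>\<^bsub>M\<^esub> A)"

lemma (in ring) finsum_swap:
  assumes "finite I" "finite J" "\<And>i j. i \<in> I \<Longrightarrow> j \<in> J \<Longrightarrow> f i j \<in> carrier R"
  shows "(\<Oplus>i\<in>I. \<Oplus>j\<in>J. f i j) = (\<Oplus>j\<in>J. \<Oplus>i\<in>I. f i j)"
  using assms(1,3)
proof (induction I rule: finite_induct)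
  case empty
  then show ?case by simp
next
  case (insert x F)
  then have "(\<Oplus>i\<in>insert x F. \<Oplus>j\<in>J. f i j) = (\<Oplus>j\<in>J. f x j) \<oplus> (\<Oplus>j\<in>J. \<Oplus>i\<in>F. f i j)"
    by (simp add: finsum_insert Pi_def)
  also have "\<dots> = (\<Oplus>j\<in>J. f x j \<oplus> (\<Oplus>i\<in>F. f i j))"
    using insert.prems by (simp add: finsum_addf Pi_def)
  also have "\<dots> = (\<Oplus>j\<in>J. \<Oplus>i\<in>insert x F. f i j)"
    using insert by (intro finsum_cong') (auto simp: finsum_insert Pi_def)
  finally show ?case .
qed

lemma matrix_eqI:
  assumes "A \<in> carrier (matrix_ring R n)" "B \<in> carrier (matrix_ring R n)"
    and "\<And>i j. i < n \<Longrightarrow> j < n \<Longrightarrow> A (i, j) = B (i, j)"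
  shows "A = B"
  using assms by (intro PiE_ext[of A "{..<n} \<times> {..<n}" "\<lambda>_. carrier R"]) (auto simp: matrix_ring_def)

lemma matrix_entry:
  assumes "A \<in> carrier (matrix_ring R n)" "i < n" "j < n"
  shows "A (i, j) \<in> carrier R"
  using assms by (auto simp: matrix_ring_def)

lemma matrix_ring_entries:
  assumes "i < n" "j < n"
  shows "(A \<otimes>\<^bsub>matrix_ring R n\<^esub> B) (i, j) = (\<Oplus>\<^bsub>R\<^esub>k\<in>{..<n}. A (i, k) \<otimes>\<^bsub>R\<^esub> B (k, j))"
    and "(A \<oplus>\<^bsub>matrix_ring R n\<^esub> B) (i, j) = A (i, j) \<oplus>\<^bsub>R\<^esub> B (i, j)"
    and "\<one>\<^bsub>matrix_ring R n\<^esub> (i, j) = (if i = j then \<one>\<^bsub>R\<^esub> else \<zero>\<^bsub>R\<^esub>)"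
    and "\<zero>\<^bsub>matrix_ring R n\<^esub> (i, j) = \<zero>\<^bsub>R\<^esub>"
  using assms by (auto simp: matrix_ring_def)

lemma (in ring) matrix_ring_closed:
  shows "A \<in> carrier (matrix_ring R n) \<Longrightarrow> B \<in> carrier (matrix_ring R n)
      \<Longrightarrow> A \<otimes>\<^bsub>matrix_ring R n\<^esub> B \<in> carrier (matrix_ring R n)"
    and "A \<in> carrier (matrix_ring R n) \<Longrightarrow> B \<in> carrier (matrix_ring R n)
      \<Longrightarrow> A \<oplus>\<^bsub>matrix_ring R n\<^esub> B \<in> carrier (matrix_ring R n)"
    and "\<one>\<^bsub>matrix_ring R n\<^esub> \<in> carrier (matrix_ring R n)"
    and "\<zero>\<^bsub>matrix_ring R n\<^esub> \<in> carrier (matrix_ring R n)"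
  by (auto simp: matrix_ring_def PiE_mem intro!: finsum_closed m_closed)

theorem (in ring) ring_matrix_ring: "ring (matrix_ring R n)"
proof -
  let ?M = "matrix_ring R n"
  note [simp] = matrix_ring_closed matrix_ring_entries matrix_entry
  note eqI = matrix_eqI[of _ R n]
  have one_l: "(\<Oplus>k\<in>{..<n}. \<one>\<^bsub>?M\<^esub> (i, k) \<otimes> f k) = f i"
    if "i < n" "\<And>k. k < n \<Longrightarrow> f k \<in> carrier R" for i and f :: "nat \<Rightarrow> 'a"
  proof -
    have "(\<Oplus>k\<in>{..<n}. \<one>\<^bsub>?M\<^esub> (i, k) \<otimes> f k) = (\<Oplus>k\<in>{..<n}. if i = k then f k else \<zero>)"
      using that by (intro finsum_cong') auto
    also have "\<dots> = f i" using that by (intro add.finprod_singleton) auto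
    finally show ?thesis .
  qed
  have one_r: "(\<Oplus>k\<in>{..<n}. f k \<otimes> \<one>\<^bsub>?M\<^esub> (k, j)) = f j"
    if "j < n" "\<And>k. k < n \<Longrightarrow> f k \<in> carrier R" for j and f :: "nat \<Rightarrow> 'a"
  proof -
    have "(\<Oplus>k\<in>{..<n}. f k \<otimes> \<one>\<^bsub>?M\<^esub> (k, j)) = (\<Oplus>k\<in>{..<n}. if j = k then f k else \<zero>)"
      using that by (intro finsum_cong') auto
    also have "\<dots> = f j" using that by (intro add.finprod_singleton) auto
    finally show ?thesis .
  qed
  have assoc: "(A \<otimes>\<^bsub>?M\<^esub> B) \<otimes>\<^bsub>?M\<^esub> C = A \<otimes>\<^bsub>?M\<^esub> (B \<otimes>\<^bsub>?M\<^esub> C)"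
    if M: "A \<in> carrier ?M" "B \<in> carrier ?M" "C \<in> carrier ?M" for A B C
  proof (rule eqI)
    fix i j assume ij: "i < n" "j < n"
    have "((A \<otimes>\<^bsub>?M\<^esub> B) \<otimes>\<^bsub>?M\<^esub> C) (i, j) = (\<Oplus>k\<in>{..<n}. \<Oplus>l\<in>{..<n}. A (i, l) \<otimes> B (l, k) \<otimes> C (k, j))"
      using M ij by (simp, intro finsum_cong') (auto simp: finsum_ldistr Pi_def)
    also have "\<dots> = (\<Oplus>l\<in>{..<n}. \<Oplus>k\<in>{..<n}. A (i, l) \<otimes> B (l, k) \<otimes> C (k, j))"
      using M ij by (intro finsum_swap) auto
    also have "\<dots> = (\<Oplus>l\<in>{..<n}. A (i, l) \<otimes> (\<Oplus>k\<in>{..<n}. B (l, k) \<otimes> C (k, j)))"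
      using M ij by (intro finsum_cong') (auto simp: finsum_rdistr Pi_def m_assoc intro!: finsum_cong')
    also have "\<dots> = (A \<otimes>\<^bsub>?M\<^esub> (B \<otimes>\<^bsub>?M\<^esub> C)) (i, j)"
      using M ij by (simp, intro finsum_cong') auto
    finally show "((A \<otimes>\<^bsub>?M\<^esub> B) \<otimes>\<^bsub>?M\<^esub> C) (i, j) = (A \<otimes>\<^bsub>?M\<^esub> (B \<otimes>\<^bsub>?M\<^esub> C)) (i, j)" .
  qed (use M in auto)
  show ?thesis
  proof (rule ringI)
    show "abelian_group ?M"
    proof (rule abelian_groupI)
      fix A assume A: "A \<in> carrier ?M"
      let ?B = "\<lambda>ij\<in>{..<n} \<times> {..<n}. \<ominus> A ij"
      have B: "?B \<in> carrier ?M" using A by (auto simp: matrix_ring_def PiE_mem)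
      have "?B \<oplus>\<^bsub>?M\<^esub> A = \<zero>\<^bsub>?M\<^esub>"
        by (rule eqI) (use A B in \<open>auto simp: l_neg\<close>)
      with B show "\<exists>B\<in>carrier ?M. B \<oplus>\<^bsub>?M\<^esub> A = \<zero>\<^bsub>?M\<^esub>" by blast
    qed (auto intro!: eqI simp: a_ac)
    show "Group.monoid ?M"
      by (rule monoidI) (auto intro!: eqI simp: assoc one_l one_r)
  next
    fix A B C assume M: "A \<in> carrier ?M" "B \<in> carrier ?M" "C \<in> carrier ?M"
    show "(A \<oplus>\<^bsub>?M\<^esub> B) \<otimes>\<^bsub>?M\<^esub> C = A \<otimes>\<^bsub>?M\<^esub> C \<oplus>\<^bsub>?M\<^esub> B \<otimes>\<^bsub>?M\<^esub> C"
    proof (rule eqI)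
      fix i j assume ij: "i < n" "j < n"
      have "((A \<oplus>\<^bsub>?M\<^esub> B) \<otimes>\<^bsub>?M\<^esub> C) (i, j) = (\<Oplus>k\<in>{..<n}. A (i, k) \<otimes> C (k, j) \<oplus> B (i, k) \<otimes> C (k, j))"
        unfolding matrix_ring_entries(1)[OF ij] using M ij by (intro finsum_cong') (auto simp: l_distr)
      also have "\<dots> = (A \<otimes>\<^bsub>?M\<^esub> C \<oplus>\<^bsub>?M\<^esub> B \<otimes>\<^bsub>?M\<^esub> C) (i, j)"
        using M ij by (simp add: finsum_addf Pi_def)
      finally show "((A \<oplus>\<^bsub>?M\<^esub> B) \<otimes>\<^bsub>?M\<^esub> C) (i, j) = (A \<otimes>\<^bsub>?M\<^esub> C \<oplus>\<^bsub>?M\<^esub> B \<otimes>\<^bsub>?M\<^esub> C) (i, j)" .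
    qed (use M in auto)
    show "C \<otimes>\<^bsub>?M\<^esub> (A \<oplus>\<^bsub>?M\<^esub> B) = C \<otimes>\<^bsub>?M\<^esub> A \<oplus>\<^bsub>?M\<^esub> C \<otimes>\<^bsub>?M\<^esub> B"
    proof (rule eqI)
      fix i j assume ij: "i < n" "j < n"
      have "(C \<otimes>\<^bsub>?M\<^esub> (A \<oplus>\<^bsub>?M\<^esub> B)) (i, j) = (\<Oplus>k\<in>{..<n}. C (i, k) \<otimes> A (k, j) \<oplus> C (i, k) \<otimes> B (k, j))"
        unfolding matrix_ring_entries(1)[OF ij] using M ij by (intro finsum_cong') (auto simp: r_distr)
      also have "\<dots> = (C \<otimes>\<^bsub>?M\<^esub> A \<oplus>\<^bsub>?M\<^esub> C \<otimes>\<^bsub>?M\<^esub> B) (i, j)"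
        using M ij by (simp add: finsum_addf Pi_def)
      finally show "(C \<otimes>\<^bsub>?M\<^esub> (A \<oplus>\<^bsub>?M\<^esub> B)) (i, j) = (C \<otimes>\<^bsub>?M\<^esub> A \<oplus>\<^bsub>?M\<^esub> C \<otimes>\<^bsub>?M\<^esub> B) (i, j)" .
    qed (use M in auto)
  qed
qed

lemma (in ring) matrix_ring_minus_entries:
  assumes M: "A \<in> carrier (matrix_ring R n)" "B \<in> carrier (matrix_ring R n)"
    and ij: "i < n" "j < n"
  shows "(A \<ominus>\<^bsub>matrix_ring R n\<^esub> B) (i, j) = A (i, j) \<ominus> B (i, j)"
proof -
  interpret M: ring "matrix_ring R n" by (rule ring_matrix_ring)
  let ?D = "A \<ominus>\<^bsub>matrix_ring R n\<^esub> B"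
  have D: "?D \<in> carrier (matrix_ring R n)" using M by simp
  have "?D \<oplus>\<^bsub>matrix_ring R n\<^esub> B = A"
    using M by (simp add: M.minus_eq M.a_assoc M.l_neg)
  then have "?D (i, j) \<oplus> B (i, j) = A (i, j)"
    using ij by (metis matrix_ring_entries(2))
  moreover have "?D (i, j) \<in> carrier R" "B (i, j) \<in> carrier R"
    using D M ij by (auto intro: matrix_entry)
  ultimately show ?thesis
    by (metis a_assoc a_inv_closed minus_eq r_neg r_zero)
qed


section \<open>A type to host the ring\<close>

text \<open>An existential statement about rings has to fix the type of the elements. The carrier may be
  any subset of this type and its operations are unrelated to those of the type, so the type only
  bounds the cardinality. This one, the underlying type of the field of fractions of the polynomial
  ring over the complex numbers in countably many indeterminates, has the cardinality of the
  continuum.\<close>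

type_synonym host = "((nat \<Rightarrow>\<^sub>0 nat) \<Rightarrow>\<^sub>0 complex) fract"

end

theory Submission
  imports Defs
begin

text \<open>Let \<open>A\<close> be the algebra spanned by the complex monomials in \<open>x\<^sub>0, x\<^sub>1, \<dots>\<close> in which the
  exponent of each \<open>x\<^sub>n\<close> is \<open>0\<close> or greater than \<open>n\<close>, and let \<open>\<Lambda>\<close> be its localization at the elements
  divisible by no \<open>x\<^sub>n\<close>. As in Nagata's examples, the maximal ideals of \<open>\<Lambda>\<close> are the ideals \<open>M\<^sub>n\<close> of
  fractions whose numerator is divisible by \<open>x\<^sub>n\<close>. A nonzero prime \<open>P\<close> contains some \<open>M\<^sub>n\<close>: a norm
  replaces an element of \<open>P\<close> by a multiple whose exponents are divisible by a large \<open>q\<close>, and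
  splitting off powers \<open>x\<^sub>n^q\<close> from it leaves a unit. As \<open>M\<^sub>n\<close> is generated by the
  \<open>x\<^sub>n^(n + 1 + i)\<close> with \<open>i \<le> n\<close>, Cohen's theorem shows that \<open>\<Lambda>\<close> is Noetherian.

  These generators of \<open>M\<^sub>n\<close> are independent modulo \<open>M\<^sub>n\<^sup>2\<close>, and for \<open>n = N\<^sup>2 - 1\<close> there are enough of
  them to fill an \<open>N \<times> N\<close> matrix \<open>C\<close> of trace \<open>0\<close> with independent entries. If \<open>C = [A, B]\<close>, then
  \<open>tr (C A) = tr (C B) = 0\<close> are linear relations between the entries of \<open>C\<close>; independence forces
  \<open>A\<close> and \<open>B\<close> to be scalar modulo \<open>M\<^sub>n\<close>, so that the entries of \<open>[A, B]\<close> lie in \<open>M\<^sub>n\<^sup>2\<close>, a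
  contradiction.\<close>

section \<open>Cohen's theorem and dimension one\<close>

text \<open>The colon ideal \<open>I : a\<close>, the second of the two enlarged ideals in the proof
  of Cohen's theorem.\<close>

lemma (in cring) ideal_colon:
  assumes "ideal I R" "a \<in> carrier R"
  shows "ideal {r \<in> carrier R. r \<otimes> a \<in> I} R"
proof (rule idealI)
  interpret I: ideal I R by fact
  show "ring R" by (rule ring_axioms)
  show "subgroup {r \<in> carrier R. r \<otimes> a \<in> I} (add_monoid R)"
    using assms(2)
    by (intro add.subgroupI)
       (auto simp: l_distr l_minus I.a_closed intro!: I.a_inv_closed exI[of _ \<zero>])
  fix x r assume "x \<in> {r \<in> carrier R. r \<otimes> a \<in> I}" "r \<in> carrier R"
  then have x: "x \<in> carrier R" "x \<otimes> a \<in> I" "r \<in> carrier R" by auto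
  show "r \<otimes> x \<in> {r \<in> carrier R. r \<otimes> a \<in> I}"
    using x assms(2) I.I_l_closed by (simp add: m_assoc)
  then show "x \<otimes> r \<in> {r \<in> carrier R. r \<otimes> a \<in> I}"
    using x by (simp add: m_comm)
qed

text \<open>Cohen's theorem. By Zorn, a failure yields an ideal \<open>P\<close> maximal among those
  that are not finitely generated. If a product \<open>a \<otimes> b\<close> lies in
  \<open>P\<close> but neither factor does, then \<open>P + (a)\<close> and \<open>P : a\<close> are
  strictly larger, hence finitely generated, and their generators yield finitely many for
  \<open>P\<close>. So \<open>P\<close> is prime, against the hypothesis.\<close>

lemma (in cring) noetherian_ring_if_primes_finitely_generated:
  assumes fg: "\<And>P. primeideal P R \<Longrightarrow> \<exists>A\<subseteq>carrier R. finite A \<and> P = Idl A"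
  shows "noetherian_ring R"
proof (rule ccontr)
  define F where "F = {I. ideal I R \<and> \<not> (\<exists>A\<subseteq>carrier R. finite A \<and> I = Idl A)}"
  assume "\<not> noetherian_ring R"
  then have "F \<noteq> {}"
    unfolding F_def noetherian_ring_def noetherian_ring_axioms_def using ring_axioms by blast
  moreover have "\<Union>C \<in> F" if C: "C \<noteq> {}" "subset.chain F C" for C
  proof -
    have CF: "C \<subseteq> F" using C(2) by (simp add: subset_chain_def)
    have "subset.chain {I. ideal I R} C" using C(2) by (auto simp: subset_chain_def F_def)
    then have id: "ideal (\<Union>C) R" using chain_Union_is_ideal[of C] C(1) by simp
    moreover have False if A: "A \<subseteq> carrier R" "finite A" "\<Union>C = Idl A" for A
    proof -
      have "A \<subseteq> \<Union>C" using A genideal_self by blast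
      \<comment> \<open>A finite generating set of the union already lies in one member of the
        chain, which then equals the union.\<close>
      then obtain I where I: "I \<in> C" "A \<subseteq> I"
        using finite_subset_Union_chain[OF A(2) _ C] by blast
      then have idI: "ideal I R" using CF by (auto simp: F_def)
      have "I = Idl A"
        using I A(3) genideal_minimal[OF idI I(2)] by blast
      then show False using I CF A by (auto simp: F_def)
    qed
    ultimately show ?thesis by (auto simp: F_def)
  qed
  ultimately obtain P where PF: "P \<in> F" and max: "\<And>J. J \<in> F \<Longrightarrow> P \<subseteq> J \<Longrightarrow> J = P"
    using subset_Zorn_nonempty[of F] by blast
  have P: "ideal P R" using PF by (simp add: F_def)
  interpret P: ideal P R by fact
  have big: "\<exists>A\<subseteq>carrier R. finite A \<and> J = Idl A" if "ideal J R" "P \<subset> J" for J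
    using that max[of J] by (auto simp: F_def)
  have "primeideal P R"
  proof (rule primeidealI[OF P is_cring])
    have "carrier R = Idl {\<one>}" by (simp add: genideal_one)
    moreover have "{\<one>} \<subseteq> carrier R" "finite {\<one>}" by auto
    ultimately show "carrier R \<noteq> P" using PF unfolding F_def by blast
    fix a b assume ab: "a \<in> carrier R" "b \<in> carrier R" "a \<otimes> b \<in> P"
    show "a \<in> P \<or> b \<in> P"
    proof (rule ccontr)
      assume neg: "\<not> (a \<in> P \<or> b \<in> P)"
      have add: "ideal (I <+> PIdl a) R" if "ideal I R" for I
        using that ab(1) by (intro add_ideals cgenideal_ideal)
      have left: "I \<subseteq> I <+> PIdl a" if "ideal I R" for I
      proof
        fix x assume x: "x \<in> I"
        then have "x \<in> carrier R" using that by (meson ideal.Icarr)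
        then have "x = x \<oplus> \<zero> \<otimes> a" using ab by simp
        then show "x \<in> I <+> PIdl a"
          using x unfolding set_add_def' cgenideal_def by blast
      qed
      have "a = \<zero> \<oplus> \<one> \<otimes> a" using ab by simp
      then have "a \<in> P <+> PIdl a"
        using P.zero_closed unfolding set_add_def' cgenideal_def by blast
      then have "P \<subset> P <+> PIdl a" using left[OF P] neg by blast
      then obtain A where A: "A \<subseteq> carrier R" "finite A" "P <+> PIdl a = Idl A"
        using big[OF add[OF P]] by blast
      have "\<forall>x\<in>A. \<exists>p\<in>P. \<exists>r\<in>carrier R. x = p \<oplus> r \<otimes> a"
        using genideal_self[OF A(1)] A(3) unfolding set_add_def' cgenideal_def by blast
      then obtain p where p: "\<And>x. x \<in> A \<Longrightarrow> p x \<in> P"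
        "\<And>x. x \<in> A \<Longrightarrow> \<exists>r\<in>carrier R. x = p x \<oplus> r \<otimes> a" by metis
      define J where "J = {r \<in> carrier R. r \<otimes> a \<in> P}"
      have J: "ideal J R" unfolding J_def by (rule ideal_colon[OF P ab(1)])
      have "P \<subseteq> J" using P.Icarr P.I_r_closed ab by (auto simp: J_def)
      moreover have "b \<in> J" using ab by (simp add: J_def m_comm)
      ultimately obtain B where B: "B \<subseteq> carrier R" "finite B" "J = Idl B"
        using big[OF J] neg by blast
      \<comment> \<open>Generators for \<open>P\<close>: the \<open>P\<close>-parts of the
        generators of \<open>P + (a)\<close>, and \<open>a\<close> times the generators of the colon
        ideal \<open>J\<close>.\<close>
      define G where "G = p ` A \<union> (\<lambda>r. r \<otimes> a) ` B"
      have BJ: "B \<subseteq> J" using B genideal_self by blast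
      have GP: "G \<subseteq> P" using p BJ by (auto simp: G_def J_def)
      then have G: "G \<subseteq> carrier R" using P.Icarr by blast
      have idG: "ideal (Idl G) R" by (rule genideal_ideal[OF G])
      interpret G: ideal "Idl G" R by fact
      have "P \<subseteq> Idl G"
      proof
        fix x assume x: "x \<in> P"
        have "A \<subseteq> Idl G <+> PIdl a"
        proof
          fix y assume y: "y \<in> A"
          then have "p y \<in> Idl G" using genideal_self[OF G] by (auto simp: G_def)
          then show "y \<in> Idl G <+> PIdl a"
            using p(2)[OF y] unfolding set_add_def' cgenideal_def by blast
        qed
        then have "Idl A \<subseteq> Idl G <+> PIdl a"
          by (rule genideal_minimal[OF add[OF idG]])
        then have "x \<in> Idl G <+> PIdl a" using x left[OF P] A(3) by blast
        then obtain y r where yr: "y \<in> Idl G" "r \<in> carrier R" "x = y \<oplus> r \<otimes> a"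
          unfolding set_add_def' cgenideal_def by blast
        have yP: "y \<in> P" using genideal_minimal[OF P GP] yr by blast
        \<comment> \<open>Both \<open>x\<close> and \<open>y\<close> lie in \<open>P\<close>, hence
          so does the rest; thus \<open>r\<close> is in \<open>J = Idl B\<close>, and multiplication
          by \<open>a\<close> carries \<open>Idl B\<close> into \<open>Idl G\<close>.\<close>
        have "r \<otimes> a = x \<oplus> \<ominus> y"
          using yr P.Icarr[OF yP] ab(1) by (simp add: a_ac r_neg1 r_neg2)
        also have "\<dots> \<in> P" using x yP by (intro P.a_closed P.a_inv_closed)
        finally have "r \<in> Idl B" using yr(2) unfolding B(3)[symmetric] J_def by simp
        moreover have "Idl B \<subseteq> {r \<in> carrier R. r \<otimes> a \<in> Idl G}"
          by (rule genideal_minimal[OF ideal_colon[OF idG ab(1)]])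
             (use genideal_self[OF G] B in \<open>auto simp: G_def\<close>)
        ultimately show "x \<in> Idl G" using yr by (auto intro: G.a_closed)
      qed
      then have "P = Idl G" using genideal_minimal[OF P GP] by blast
      moreover have "finite G" using A B by (simp add: G_def)
      ultimately show False using PF G by (auto simp: F_def)
    qed
  qed
  then show False using fg[of P] PF by (auto simp: F_def)
qed

text \<open>In a chain of three primes the middle one strictly contains another ideal, so it is
  nonzero and therefore maximal, which leaves no room for the third. As \<open>{\<zero>}\<close> is
  prime in a domain, \<open>{\<zero>} \<subset> Q\<close> supplies length 1.\<close>

lemma (in domain) krull_dim_1I:
  assumes max: "\<And>P. primeideal P R \<Longrightarrow> P \<noteq> {\<zero>} \<Longrightarrow> maximalideal P R"
    and ex: "primeideal Q R" "Q \<noteq> {\<zero>}"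
  shows "krull_dim R = 1"
proof -
  have "d \<le> 1" if "prime_chain R d P" for d P
  proof (rule ccontr)
    assume "\<not> d \<le> 1"
    then have pr: "primeideal (P 0) R" "primeideal (P 1) R" "primeideal (P 2) R"
      and sub: "P 0 \<subset> P 1" "P 1 \<subset> P 2"
      using that by (auto simp: prime_chain_def numeral_2_eq_2)
    interpret P0: primeideal "P 0" R by (rule pr)
    interpret P2: primeideal "P 2" R by (rule pr)
    have "P 1 \<noteq> {\<zero>}" using sub(1) P0.zero_closed by (metis empty_iff subset_singletonD psubsetE)
    then interpret P1: maximalideal "P 1" R by (rule max[OF pr(2)])
    have "P 2 = P 1 \<or> P 2 = carrier R"
      using sub(2) by (intro P1.I_maximal P2.is_ideal P2.a_subset) (rule psubset_imp_subset)
    then show False using sub(2) P2.I_notcarr by (metis psubset_eq)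
  qed
  then have "krull_dim R \<le> 1"
    unfolding krull_dim_def by (intro Sup_least) (auto simp: one_enat_def)
  moreover have "prime_chain R 1 (\<lambda>i. if i = 0 then {\<zero>} else Q)"
  proof -
    interpret Q: primeideal Q R by (rule ex)
    show ?thesis using ex zeroprimeideal Q.zero_closed by (auto simp: prime_chain_def)
  qed
  then have "1 \<le> krull_dim R"
    unfolding krull_dim_def one_enat_def by (intro Sup_upper) blast
  ultimately show ?thesis by (rule antisym)
qed


section \<open>Polynomials with exponent gaps\<close>

type_synonym mpoly = "(nat \<Rightarrow>\<^sub>0 nat) \<Rightarrow>\<^sub>0 complex"

abbreviation exponent :: "(nat \<Rightarrow>\<^sub>0 nat) \<Rightarrow> nat \<Rightarrow> nat" where
  "exponent \<equiv> Poly_Mapping.lookup"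

abbreviation monomials :: "mpoly \<Rightarrow> (nat \<Rightarrow>\<^sub>0 nat) set" where
  "monomials \<equiv> Poly_Mapping.keys"

text \<open>Divisibility by \<open>x\<^sub>n^e\<close> in the full polynomial ring, phrased through
  exponents; \<open>0\<close> belongs to all these sets.\<close>

definition order_ge :: "nat \<Rightarrow> nat \<Rightarrow> mpoly set" where
  "order_ge n e = {f. \<forall>m\<in>monomials f. e \<le> exponent m n}"

definition gap_algebra :: "mpoly set" where
  "gap_algebra = {f. \<forall>m\<in>monomials f. \<forall>n. exponent m n \<noteq> 0 \<longrightarrow> n < exponent m n}"

text \<open>The complement of a union of prime ideals of the algebra, hence closed under products;
  it excludes \<open>0\<close>.\<close>

definition denominators :: "mpoly set" where
  "denominators = {g \<in> gap_algebra. \<forall>n. g \<notin> order_ge n 1}"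

abbreviation xpow :: "nat \<Rightarrow> nat \<Rightarrow> mpoly" where
  "xpow n e \<equiv> Poly_Mapping.single (Poly_Mapping.single n e) 1"

text \<open>Translation of exponents by \<open>t\<close> is injective, so no two terms collide and
  none cancels.\<close>

lemma monomials_mult_single:
  fixes f :: mpoly
  assumes "c \<noteq> 0"
  shows "monomials (Poly_Mapping.single t c * f) = (\<lambda>m. t + m) ` monomials f"
proof
  show "monomials (Poly_Mapping.single t c * f) \<subseteq> (\<lambda>m. t + m) ` monomials f"
    using keys_mult[of "Poly_Mapping.single t c" f] assms by auto
  have "Poly_Mapping.lookup (Poly_Mapping.single t c * f) (t + m) = c * Poly_Mapping.lookup f m" for m
  proof -
    have "Poly_Mapping.lookup (Poly_Mapping.single t c * f) (t + m) =
        (\<Sum>l. c * (\<Sum>q. Poly_Mapping.lookup f q when t + m = l + q) when l = t)"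
      unfolding lookup_mult by (rule Sum_any.cong) (auto simp: lookup_single when_def)
    also have "\<dots> = c * Poly_Mapping.lookup f m"
      by (simp add: Sum_any_when_equal)
    finally show ?thesis .
  qed
  then show "(\<lambda>m. t + m) ` monomials f \<subseteq> monomials (Poly_Mapping.single t c * f)"
    using assms by (auto simp: in_keys_iff)
qed

section \<open>Orders in a single indeterminate\<close>

lemma order_ge_0 [simp]: "order_ge n 0 = UNIV"
  by (simp add: order_ge_def)

lemma order_ge_antimono: "a \<le> b \<Longrightarrow> f \<in> order_ge n b \<Longrightarrow> f \<in> order_ge n a"
  by (force simp: order_ge_def)

lemma order_ge_add: "f \<in> order_ge n a \<Longrightarrow> g \<in> order_ge n a \<Longrightarrow> f + g \<in> order_ge n a"
  using keys_add[of f g] by (auto simp: order_ge_def)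

lemma order_ge_diff: "f \<in> order_ge n a \<Longrightarrow> g \<in> order_ge n a \<Longrightarrow> f - g \<in> order_ge n a"
  using keys_diff[of f g] by (auto simp: order_ge_def)

lemma order_ge_mult: "f \<in> order_ge n a \<Longrightarrow> g \<in> order_ge n b \<Longrightarrow> f * g \<in> order_ge n (a + b)"
  using keys_mult[of f g] by (fastforce simp: order_ge_def lookup_add intro: add_mono)

lemma zero_order_ge [simp]: "0 \<in> order_ge n a"
  by (simp add: order_ge_def)

text \<open>Orders add up: the parts \<open>f0\<close> and \<open>g0\<close> of lowest order are
  nonzero, their product is nonzero because polynomials form a domain, and it differs from
  \<open>f * g\<close> only by terms of higher order.\<close>

lemma not_order_ge_mult:
  assumes f: "f \<in> order_ge n a" "f \<notin> order_ge n (Suc a)"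
    and g: "g \<in> order_ge n b" "g \<notin> order_ge n (Suc b)"
  shows "f * g \<notin> order_ge n (Suc (a + b))"
proof
  assume fg: "f * g \<in> order_ge n (Suc (a + b))"
  have "\<exists>f0. f0 \<noteq> 0 \<and> (\<forall>m\<in>monomials f0. exponent m n = a) \<and> f - f0 \<in> order_ge n (Suc a)"
    if f: "f \<in> order_ge n a" "f \<notin> order_ge n (Suc a)" for f a
  proof -
    define f0 where "f0 = Poly_Mapping.mapp (\<lambda>m c. if exponent m n = a then c else 0) f"
    have lk: "Poly_Mapping.lookup f0 m = (if exponent m n = a then Poly_Mapping.lookup f m else 0)" for m
      by (auto simp: f0_def lookup_mapp when_def in_keys_iff)
    obtain m where m: "m \<in> monomials f" "exponent m n = a"
      using f by (auto simp: order_ge_def not_less_eq_eq dest: antisym)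
    then have "f0 \<noteq> 0" using lk[of m] by (auto simp: in_keys_iff)
    moreover have "\<forall>m\<in>monomials f0. exponent m n = a" by (metis in_keys_iff lk)
    moreover have "f - f0 \<in> order_ge n (Suc a)"
      using f(1) by (force simp: order_ge_def in_keys_iff lk lookup_minus split: if_splits)
    ultimately show ?thesis by blast
  qed
  from this[OF f] this[OF g] obtain f0 g0
    where f0: "f0 \<noteq> 0" "\<forall>m\<in>monomials f0. exponent m n = a" "f - f0 \<in> order_ge n (Suc a)"
      and g0: "g0 \<noteq> 0" "\<forall>m\<in>monomials g0. exponent m n = b" "g - g0 \<in> order_ge n (Suc b)"
    by blast
  have f0_ge: "f0 \<in> order_ge n a" using f0 by (simp add: order_ge_def)
  have "f0 * g0 = f * g - (f0 * (g - g0) + (f - f0) * g)" by (simp add: algebra_simps)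
  also have "\<dots> \<in> order_ge n (Suc (a + b))"
    using order_ge_mult[OF f0_ge g0(3)] order_ge_mult[OF f0(3) g(1)] fg
    by (intro order_ge_diff order_ge_add) simp_all
  finally have "f0 * g0 \<in> order_ge n (Suc (a + b))" .
  moreover obtain m where m: "m \<in> monomials (f0 * g0)"
    using f0(1) g0(1) by (metis keys_eq_empty mult_eq_0_iff ex_in_conv)
  moreover have "exponent m n = a + b"
    using m keys_mult[of f0 g0] f0(2) g0(2) by (fastforce simp: lookup_add)
  ultimately show False by (auto simp: order_ge_def)
qed

lemma order_ge_1_prime: "f * g \<in> order_ge n 1 \<Longrightarrow> f \<in> order_ge n 1 \<or> g \<in> order_ge n 1"
  using not_order_ge_mult[of f n 0 g 0] by auto

lemma xpow_order_ge: "xpow n e \<in> order_ge n e" "xpow n e \<notin> order_ge n (Suc e)"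
  by (auto simp: order_ge_def)

section \<open>Closure properties of the algebra and of its denominators\<close>

lemma gap_algebra_add: "f \<in> gap_algebra \<Longrightarrow> g \<in> gap_algebra \<Longrightarrow> f + g \<in> gap_algebra"
  using keys_add[of f g] unfolding gap_algebra_def by blast

lemma gap_algebra_uminus: "f \<in> gap_algebra \<Longrightarrow> - f \<in> gap_algebra"
  unfolding gap_algebra_def by (simp add: in_keys_iff)

lemma gap_algebra_mult:
  assumes "f \<in> gap_algebra" "g \<in> gap_algebra"
  shows "f * g \<in> gap_algebra"
  unfolding gap_algebra_def
proof (intro CollectI ballI allI impI)
  fix m n assume m: "m \<in> monomials (f * g)" "exponent m n \<noteq> 0"
  then obtain a b where ab: "a \<in> monomials f" "b \<in> monomials g" "m = a + b"
    using keys_mult[of f g] by blast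
  then have "exponent a n = 0 \<or> n < exponent a n" "exponent b n = 0 \<or> n < exponent b n"
    using assms by (auto simp: gap_algebra_def)
  then show "n < exponent m n" using m(2) ab(3) by (auto simp: lookup_add)
qed

lemma zero_gap_algebra [simp]: "0 \<in> gap_algebra" and one_gap_algebra [simp]: "1 \<in> gap_algebra"
  by (simp_all add: gap_algebra_def)

lemma gap_algebra_power: "f \<in> gap_algebra \<Longrightarrow> f ^ k \<in> gap_algebra"
  by (induction k) (auto intro: gap_algebra_mult)

lemma xpow_gap_algebra: "n < e \<Longrightarrow> xpow n e \<in> gap_algebra"
  by (auto simp: gap_algebra_def lookup_single when_def)

lemma gap_algebra_order_ge: "f \<in> gap_algebra \<Longrightarrow> f \<in> order_ge n 1 \<Longrightarrow> f \<in> order_ge n (Suc n)"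
  by (simp add: gap_algebra_def order_ge_def Suc_le_eq)

lemma one_denominators [simp]: "1 \<in> denominators"
  by (simp add: denominators_def order_ge_def)

lemma denominators_mult: "f \<in> denominators \<Longrightarrow> g \<in> denominators \<Longrightarrow> f * g \<in> denominators"
  unfolding denominators_def using gap_algebra_mult order_ge_1_prime by blast

lemma denominators_nonzero: "g \<in> denominators \<Longrightarrow> g \<noteq> 0"
  by (auto simp: denominators_def)

lemma denominators_gap: "g \<in> denominators \<Longrightarrow> g \<in> gap_algebra"
  by (auto simp: denominators_def)

text \<open>The cofactor is formed in the full polynomial ring and may leave
  \<open>gap_algebra\<close>; the description of its monomials allows membership to be checked
  afterwards.\<close>

lemma xpow_dvd:
  assumes "f \<in> order_ge n e"
  obtains h where "f = xpow n e * h" "monomials f = (\<lambda>m. Poly_Mapping.single n e + m) ` monomials h"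
proof -
  define h where "h = (\<Sum>m\<in>monomials f. Poly_Mapping.single (m - Poly_Mapping.single n e) (Poly_Mapping.lookup f m))"
  have split: "Poly_Mapping.single n e + (m - Poly_Mapping.single n e) = m" if "m \<in> monomials f" for m
    using that assms
    by (intro poly_mapping_eqI) (auto simp: order_ge_def lookup_add lookup_minus lookup_single when_def)
  have "xpow n e * h = (\<Sum>m\<in>monomials f. Poly_Mapping.single m (Poly_Mapping.lookup f m))"
    unfolding h_def sum_distrib_left by (intro sum.cong refl) (simp add: mult_single split)
  also have "\<dots> = f"
    by (intro poly_mapping_eqI) (simp add: lookup_sum lookup_single when_def in_keys_iff)
  finally have f: "f = xpow n e * h" ..
  show thesis
  proof (rule that)
    show "f = xpow n e * h" by (rule f)
    have "monomials (xpow n e * h) = (\<lambda>m. Poly_Mapping.single n e + m) ` monomials h"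
      by (rule monomials_mult_single) simp
    then show "monomials f = (\<lambda>m. Poly_Mapping.single n e + m) ` monomials h" using f by simp
  qed
qed


section \<open>Norms\<close>

text \<open>The substitution of \<open>w * x\<^sub>n\<close> for \<open>x\<^sub>n\<close>.\<close>

definition twist :: "complex \<Rightarrow> nat \<Rightarrow> mpoly \<Rightarrow> mpoly" where
  "twist w n f = Poly_Mapping.mapp (\<lambda>m c. w ^ exponent m n * c) f"

lemma lookup_twist: "Poly_Mapping.lookup (twist w n f) m = w ^ exponent m n * Poly_Mapping.lookup f m"
  by (auto simp: twist_def lookup_mapp when_def in_keys_iff)

lemma twist_single: "twist w n (Poly_Mapping.single m c) = Poly_Mapping.single m (w ^ exponent m n * c)"
  by (rule poly_mapping_eqI) (simp add: lookup_twist lookup_single when_def)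

lemma twist_sum: "twist w n (\<Sum>i\<in>I. f i) = (\<Sum>i\<in>I. twist w n (f i))"
  by (rule poly_mapping_eqI) (simp add: lookup_twist lookup_sum sum_distrib_left)

lemma sum_singles: "(\<Sum>m\<in>monomials f. Poly_Mapping.single m (Poly_Mapping.lookup f m)) = f"
  by (intro poly_mapping_eqI) (simp add: lookup_sum lookup_single when_def in_keys_iff)

lemma twist_mult: "twist w n (f * g) = twist w n f * twist w n g"
proof -
  let ?F = "\<lambda>m. Poly_Mapping.single m (Poly_Mapping.lookup f m)"
  let ?G = "\<lambda>m. Poly_Mapping.single m (Poly_Mapping.lookup g m)"
  have "twist w n (f * g) = twist w n ((\<Sum>a\<in>monomials f. ?F a) * (\<Sum>b\<in>monomials g. ?G b))"
    by (simp add: sum_singles)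
  also have "\<dots> = (\<Sum>a\<in>monomials f. \<Sum>b\<in>monomials g. twist w n (?F a * ?G b))"
    by (simp add: sum_product twist_sum)
  also have "\<dots> = (\<Sum>a\<in>monomials f. \<Sum>b\<in>monomials g. twist w n (?F a) * twist w n (?G b))"
    by (intro sum.cong refl) (simp add: mult_single twist_single lookup_add power_add mult_ac)
  also have "\<dots> = twist w n (\<Sum>a\<in>monomials f. ?F a) * twist w n (\<Sum>b\<in>monomials g. ?G b)"
    by (simp add: sum_product twist_sum)
  finally show ?thesis by (simp add: sum_singles)
qed

lemma twist_1: "twist w n 1 = 1"
  using twist_single[of w n 0 1] by simp

lemma twist_prod: "twist w n (\<Prod>i\<in>I. f i) = (\<Prod>i\<in>I. twist w n (f i))"
  by (induction I rule: infinite_finite_induct) (auto simp: twist_1 twist_mult)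

lemma twist_twist: "twist v n (twist w n f) = twist (v * w) n f"
  by (rule poly_mapping_eqI) (simp add: lookup_twist power_mult_distrib)

lemma twist_one [simp]: "twist 1 n f = f"
  by (rule poly_mapping_eqI) (simp add: lookup_twist)

lemma monomials_twist: "w \<noteq> 0 \<Longrightarrow> monomials (twist w n f) = monomials f"
  by (auto simp: in_keys_iff lookup_twist)

lemma primitive_root_of_unity:
  assumes "q > 0"
  obtains z :: complex where "z ^ q = 1" "\<And>k. z ^ k = 1 \<Longrightarrow> q dvd k"
proof -
  define z where "z = cis (2 * pi / real q)"
  have pow: "z ^ k = cis (2 * pi * real k / real q)" for k
    by (simp add: z_def DeMoivre mult_ac)
  have zq: "z ^ q = 1" using assms pow[of q] by simp
  have "q dvd k" if "z ^ k = 1" for k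
  proof -
    have "z ^ k = z ^ (q * (k div q) + k mod q)" by simp
    also have "\<dots> = z ^ (k mod q)" unfolding power_add power_mult zq by simp
    finally have "z ^ (k mod q) = z ^ 0" using that by simp
    \<comment> \<open>The first \<open>q\<close> powers of \<open>z\<close> are the distinct
      \<open>q\<close>-th roots of unity, so \<open>z ^ (k mod q) = z ^ 0\<close> forces
      \<open>k mod q = 0\<close>.\<close>
    moreover have "inj_on (\<lambda>k. z ^ k) {..<q}"
      using bij_betw_roots_unity[OF assms] by (simp add: pow bij_betw_def)
    ultimately have "k mod q = 0" using assms by (auto dest!: inj_onD[of _ _ _ 0] simp del: power_0)
    then show ?thesis by auto
  qed
  then show thesis using zq that by blast
qed

lemma exponent_dvd_prod:
  assumes "\<And>i m. i \<in> I \<Longrightarrow> m \<in> monomials (f i) \<Longrightarrow> d dvd exponent m k"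
    and "m \<in> monomials (\<Prod>i\<in>I. f i)"
  shows "d dvd exponent m k"
  using assms
proof (induction I arbitrary: m rule: infinite_finite_induct)
  case (insert i I)
  obtain a b where "a \<in> monomials (f i)" "b \<in> monomials (\<Prod>i\<in>I. f i)" "m = a + b"
    using insert.prems(2) insert.hyps keys_mult[of "f i" "\<Prod>i\<in>I. f i"] by auto
  moreover have "d dvd exponent a k" using insert.prems(1) calculation(1) by blast
  moreover have "d dvd exponent b k" using insert.IH insert.prems(1) calculation(2) by blast
  ultimately show ?case by (simp add: lookup_add)
qed auto

text \<open>The norm of \<open>f\<close> with respect to the automorphisms that multiply the \<open>n\<close>-th indeterminate by
  a root of unity. Divisibility by \<open>0\<close> records the absence of an indeterminate.\<close>

lemma norm_in_one_variable:
  assumes "q > 0" "f \<in> gap_algebra" "f \<noteq> 0"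
  obtains h where "h \<in> gap_algebra" "f * h \<noteq> 0"
    "\<And>m. m \<in> monomials (f * h) \<Longrightarrow> q dvd exponent m n"
    "\<And>d k m. (\<And>m. m \<in> monomials f \<Longrightarrow> d dvd exponent m k) \<Longrightarrow> m \<in> monomials (f * h) \<Longrightarrow>
      d dvd exponent m k"
proof -
  obtain z :: complex where z: "z ^ q = 1" "\<And>k. z ^ k = 1 \<Longrightarrow> q dvd k"
    using primitive_root_of_unity[OF assms(1)] by blast
  have z0: "z ^ j \<noteq> 0" for j using z(1) assms(1) by (auto simp: power_0_left)
  define T where "T j = twist (z ^ j) n f" for j
  have mT: "monomials (T j) = monomials f" for j
    unfolding T_def by (rule monomials_twist[OF z0])
  \<comment> \<open>Index 0 is left out because \<open>T 0 = f\<close>; thus \<open>f * h\<close> is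
    the full norm.\<close>
  define h where "h = (\<Prod>j\<in>{1..<q}. T j)"
  have "{..<q} = insert 0 {1..<q}" using assms(1) by auto
  then have fh: "f * h = (\<Prod>j<q. T j)" by (simp add: h_def T_def)
  show thesis
  proof (rule that)
    have "T j \<in> gap_algebra" for j using assms(2) mT by (simp add: gap_algebra_def)
    then show "h \<in> gap_algebra"
      unfolding h_def by (induction q) (auto simp: atLeastLessThanSuc gap_algebra_mult)
    have "T j \<noteq> 0" for j using assms(3) mT[of j] by (metis keys_eq_empty)
    then show "f * h \<noteq> 0" unfolding fh by simp
    show "q dvd exponent m n" if m: "m \<in> monomials (f * h)" for m
    proof -
      \<comment> \<open>Twisting permutes the factors cyclically, since \<open>T q = T 0\<close>;
        cancelling the nonzero \<open>T 0\<close> shows that the norm is invariant. Comparing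
        coefficients then gives \<open>z ^ exponent m n = 1\<close> for each of its
        monomials.\<close>
      have "twist z n (f * h) = (\<Prod>j<q. T (Suc j))"
        unfolding fh twist_prod by (simp add: T_def twist_twist)
      moreover have "T 0 * (\<Prod>j<q. T (Suc j)) = T 0 * (\<Prod>j<q. T j)"
        using prod.lessThan_Suc_shift[of T q] by (auto simp: mult.commute T_def z)
      ultimately have "twist z n (f * h) = f * h" using assms(3) by (simp add: T_def fh)
      then have "z ^ exponent m n * Poly_Mapping.lookup (f * h) m = Poly_Mapping.lookup (f * h) m"
        by (metis lookup_twist)
      then have "z ^ exponent m n = 1" using m by (simp add: in_keys_iff)
      then show ?thesis by (rule z(2))
    qed
    show "d dvd exponent m k"
      if "\<And>m. m \<in> monomials f \<Longrightarrow> d dvd exponent m k" "m \<in> monomials (f * h)" for d k m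
      using exponent_dvd_prod[of "{..<q}" T d k m] that unfolding fh mT by blast
  qed
qed

text \<open>Norms are taken in one indeterminate after another; a further norm preserves the
  divisibility already reached, including the absence of indeterminates.\<close>

lemma norm_in_all_variables:
  assumes "f \<in> gap_algebra" "f \<noteq> 0"
  obtains h q where "h \<in> gap_algebra" "f * h \<noteq> 0" "q > 0"
    "\<And>m n. m \<in> monomials (f * h) \<Longrightarrow> (if n < q then q else 0) dvd exponent m n"
proof -
  define V where "V = (\<Union>m\<in>monomials f. Poly_Mapping.keys m)"
  have "finite V" by (simp add: V_def)
  then obtain q0 where q0: "\<forall>v\<in>V. v < q0" using finite_nat_set_iff_bounded by blast
  \<comment> \<open>Since \<open>q\<close> exceeds the index of every indeterminate occurring in
    \<open>f\<close>, a nonzero multiple of \<open>q\<close> is an admissible exponent for each of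
    them.\<close>
  define q where "q = Suc q0"
  then have q_pos: "q > 0" by simp
  have vanish: "0 dvd exponent m n" if "m \<in> monomials f" "q \<le> n" for m n
  proof -
    have "n \<notin> V" using q0 that(2) by (auto simp: q_def)
    then show ?thesis using that(1) by (auto simp: V_def in_keys_iff)
  qed
  have "\<exists>h\<in>gap_algebra. f * h \<noteq> 0 \<and> (\<forall>m\<in>monomials (f * h).
      (\<forall>n<N. q dvd exponent m n) \<and> (\<forall>n\<ge>q. 0 dvd exponent m n))" for N
  proof (induction N)
    case 0
    show ?case using assms vanish by (intro bexI[of _ 1]) auto
  next
    case (Suc N)
    then obtain h where h: "h \<in> gap_algebra" "f * h \<noteq> 0"
      "\<forall>m\<in>monomials (f * h). (\<forall>n<N. q dvd exponent m n) \<and> (\<forall>n\<ge>q. 0 dvd exponent m n)"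
      by blast
    obtain h' where h': "h' \<in> gap_algebra" "f * h * h' \<noteq> 0"
      "\<And>m. m \<in> monomials (f * h * h') \<Longrightarrow> q dvd exponent m N"
      "\<And>d k m. (\<And>m. m \<in> monomials (f * h) \<Longrightarrow> d dvd exponent m k) \<Longrightarrow>
        m \<in> monomials (f * h * h') \<Longrightarrow> d dvd exponent m k"
      by (rule norm_in_one_variable[OF q_pos gap_algebra_mult[OF assms(1) h(1)] h(2), of N]) blast
    show ?case
    proof (intro bexI[of _ "h * h'"] conjI ballI allI impI)
      show "h * h' \<in> gap_algebra" using h h' by (intro gap_algebra_mult)
      show "f * (h * h') \<noteq> 0" using h' by (simp add: mult.assoc)
      fix m n assume "m \<in> monomials (f * (h * h'))"
      then have m: "m \<in> monomials (f * h * h')" by (simp add: mult.assoc)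
      show "q dvd exponent m n" if "n < Suc N"
        using that h'(3)[OF m] h'(4)[OF _ m, of q n] h(3) by (auto simp: less_Suc_eq)
      show "0 dvd exponent m n" if "q \<le> n"
        using that h'(4)[OF _ m, of 0 n] h(3) by auto
    qed
  qed
  from this[of q] obtain h where "h \<in> gap_algebra" "f * h \<noteq> 0"
    "\<forall>m\<in>monomials (f * h). (\<forall>n<q. q dvd exponent m n) \<and> (\<forall>n\<ge>q. 0 dvd exponent m n)"
    by blast
  then show thesis by (intro that[of h q]) (auto simp: q_def)
qed


section \<open>Localization\<close>

definition to_host :: "mpoly \<Rightarrow> host" where
  "to_host f = Fract f 1"

lemma to_host_simps [simp]:
  "to_host 0 = 0" "to_host 1 = 1" "to_host (f + g) = to_host f + to_host g" "to_host (f * g) = to_host f * to_host g"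
  "to_host (- f) = - to_host f"
  by (simp_all add: to_host_def Zero_fract_def One_fract_def)

lemma to_host_eq_iff [simp]: "to_host f = to_host g \<longleftrightarrow> f = g"
  by (simp add: to_host_def eq_fract)

lemma to_host_eq_0_iff [simp]: "to_host f = 0 \<longleftrightarrow> f = 0"
  using to_host_eq_iff[of f 0] by simp

lemma to_host_power: "to_host (f ^ k) = to_host f ^ k"
  by (induction k) simp_all

lemma to_host_sum: "to_host (\<Sum>i\<in>I. f i) = (\<Sum>i\<in>I. to_host (f i))"
  by (induction I rule: infinite_finite_induct) auto

definition localized :: "mpoly set \<Rightarrow> host set" where
  "localized J = {to_host f / to_host g | f g. f \<in> J \<and> g \<in> denominators}"

text \<open>For \<open>e = 0\<close> this is the ring \<open>\<Lambda>\<close> itself, for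
  \<open>e = 1\<close> the maximal ideal \<open>M\<^sub>n\<close>.\<close>

definition local_order_ge :: "nat \<Rightarrow> nat \<Rightarrow> host set" where
  "local_order_ge n e = localized (gap_algebra \<inter> order_ge n e)"

section \<open>Arithmetic of fractions and their orders\<close>

lemma localizedI: "f \<in> J \<Longrightarrow> g \<in> denominators \<Longrightarrow> to_host f / to_host g \<in> localized J"
  by (auto simp: localized_def)

lemma localized_to_host: "f \<in> J \<Longrightarrow> to_host f \<in> localized J"
  using localizedI[of f J 1] by simp

lemma localized_mono: "I \<subseteq> J \<Longrightarrow> localized I \<subseteq> localized J"
  by (auto simp: localized_def)

lemma localized_mult:
  assumes "x \<in> localized I" "y \<in> localized J" "\<And>f g. f \<in> I \<Longrightarrow> g \<in> J \<Longrightarrow> f * g \<in> K"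
  shows "x * y \<in> localized K"
proof -
  obtain f g f' g' where x: "x = to_host f / to_host g" "f \<in> I" "g \<in> denominators"
    and y: "y = to_host f' / to_host g'" "f' \<in> J" "g' \<in> denominators"
    using assms(1,2) by (auto simp: localized_def)
  have "x * y = to_host (f * f') / to_host (g * g')" by (simp add: x y)
  also have "\<dots> \<in> localized K" using x y assms(3) by (intro localizedI denominators_mult)
  finally show ?thesis .
qed

lemma local_order_ge_add:
  assumes "x \<in> local_order_ge n e" "y \<in> local_order_ge n e"
  shows "x + y \<in> local_order_ge n e"
proof -
  obtain f g f' g'
    where x: "x = to_host f / to_host g" "f \<in> gap_algebra" "f \<in> order_ge n e" "g \<in> denominators"
    and y: "y = to_host f' / to_host g'" "f' \<in> gap_algebra" "f' \<in> order_ge n e" "g' \<in> denominators"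
    using assms by (auto simp: localized_def local_order_ge_def)
  have sum: "x + y = to_host (f * g' + f' * g) / to_host (g * g')"
    using denominators_nonzero[OF x(4)] denominators_nonzero[OF y(4)]
    by (simp add: x(1) y(1) add_frac_eq)
  have "f * g' + f' * g \<in> gap_algebra"
    using x y by (intro gap_algebra_add gap_algebra_mult) (auto dest: denominators_gap)
  moreover have "f * g' + f' * g \<in> order_ge n e"
    using order_ge_mult[OF x(3), of g' 0] order_ge_mult[OF y(3), of g 0] by (intro order_ge_add) auto
  ultimately show ?thesis
    unfolding local_order_ge_def sum using x(4) y(4) by (intro localizedI denominators_mult IntI)
qed

lemma local_order_ge_mult:
  "x \<in> local_order_ge n a \<Longrightarrow> y \<in> local_order_ge n b \<Longrightarrow> x * y \<in> local_order_ge n (a + b)"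
  unfolding local_order_ge_def
  by (erule (1) localized_mult) (auto intro: gap_algebra_mult order_ge_mult)

lemma local_order_ge_0: "local_order_ge n 0 = localized gap_algebra"
  by (simp add: local_order_ge_def)

lemma local_order_ge_antimono: "a \<le> b \<Longrightarrow> local_order_ge n b \<subseteq> local_order_ge n a"
  unfolding local_order_ge_def by (intro localized_mono) (auto intro: order_ge_antimono)

lemma local_order_ge_subset: "local_order_ge n e \<subseteq> localized gap_algebra"
  unfolding local_order_ge_def by (intro localized_mono) auto

text \<open>The exponent gap in the localization. It puts products of two elements of
  \<open>M\<^sub>n\<close> into order at least \<open>2 * Suc n\<close>.\<close>

lemma local_order_ge_1: "local_order_ge n 1 = local_order_ge n (Suc n)"
proof
  show "local_order_ge n 1 \<subseteq> local_order_ge n (Suc n)"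
    unfolding local_order_ge_def by (intro localized_mono) (auto intro: gap_algebra_order_ge)
  show "local_order_ge n (Suc n) \<subseteq> local_order_ge n 1"
    by (rule local_order_ge_antimono) simp
qed

lemma localized_gap_algebra_closed:
  shows "0 \<in> localized gap_algebra" "1 \<in> localized gap_algebra"
    and "x \<in> localized gap_algebra \<Longrightarrow> y \<in> localized gap_algebra \<Longrightarrow> x + y \<in> localized gap_algebra"
    and "x \<in> localized gap_algebra \<Longrightarrow> y \<in> localized gap_algebra \<Longrightarrow> x * y \<in> localized gap_algebra"
    and "x \<in> localized gap_algebra \<Longrightarrow> - x \<in> localized gap_algebra"
proof -
  show "0 \<in> localized gap_algebra" using localized_to_host[of 0 gap_algebra] by simp
  show "1 \<in> localized gap_algebra" using localized_to_host[of 1 gap_algebra] by simp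
  show "x \<in> localized gap_algebra \<Longrightarrow> y \<in> localized gap_algebra \<Longrightarrow> x + y \<in> localized gap_algebra"
    using local_order_ge_add[of x undefined 0 y] by (simp add: local_order_ge_0)
  show mult: "x \<in> localized gap_algebra \<Longrightarrow> y \<in> localized gap_algebra \<Longrightarrow> x * y \<in> localized gap_algebra" for x y
    using local_order_ge_mult[of x undefined 0 y 0] by (simp add: local_order_ge_0)
  have "- 1 \<in> localized gap_algebra"
    using localized_to_host[OF gap_algebra_uminus[OF one_gap_algebra]] by simp
  then show "x \<in> localized gap_algebra \<Longrightarrow> - x \<in> localized gap_algebra"
    using mult[of "- 1" x] by simp
qed

lemma zero_local_order_ge: "0 \<in> local_order_ge n e"
  using localized_to_host[of 0] by (simp add: local_order_ge_def)

lemma local_order_ge_mult_left: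
  "x \<in> localized gap_algebra \<Longrightarrow> y \<in> local_order_ge n e \<Longrightarrow> x * y \<in> local_order_ge n e"
  using local_order_ge_mult[of x n 0 y e] by (simp add: local_order_ge_0)

lemma local_order_ge_uminus: "x \<in> local_order_ge n e \<Longrightarrow> - x \<in> local_order_ge n e"
  using local_order_ge_mult_left[of "- 1" x n e] localized_gap_algebra_closed(2,5) by simp

lemma local_order_ge_sum:
  "(\<And>i. i \<in> I \<Longrightarrow> x i \<in> local_order_ge n e) \<Longrightarrow> (\<Sum>i\<in>I. x i) \<in> local_order_ge n e"
  by (induction I rule: infinite_finite_induct) (auto intro: local_order_ge_add zero_local_order_ge)

lemma to_host_xpow: "n < e \<Longrightarrow> to_host (xpow n e) \<in> local_order_ge n e"
  unfolding local_order_ge_def by (intro localized_to_host IntI xpow_gap_algebra xpow_order_ge)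

text \<open>Denominators have order 0 and orders add, so a numerator of \<open>z\<close> of order 0
  would give the product order exactly \<open>e\<close>.\<close>

lemma local_order_ge_cancel_xpow:
  assumes z: "z \<in> localized gap_algebra" and zx: "z * to_host (xpow n e) \<in> local_order_ge n (Suc e)"
  shows "z \<in> local_order_ge n 1"
proof -
  obtain f g where fg: "z = to_host f / to_host g" "f \<in> gap_algebra" "g \<in> denominators"
    using z by (auto simp: localized_def)
  obtain f' g' where fg': "z * to_host (xpow n e) = to_host f' / to_host g'" "f' \<in> order_ge n (Suc e)"
    "g' \<in> denominators"
    using zx by (auto simp: localized_def local_order_ge_def)
  have "to_host f / to_host g * to_host (xpow n e) = to_host f' / to_host g'"
    using fg(1) fg'(1) by simp
  then have "to_host (f * xpow n e * g') = to_host (f' * g)"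
    using fg(3) fg'(3) by (simp add: denominators_nonzero field_simps)
  then have eq: "f * xpow n e * g' = f' * g" by (simp only: to_host_eq_iff)
  have "f \<in> order_ge n 1"
  proof (rule ccontr)
    assume "f \<notin> order_ge n 1"
    then have "f * xpow n e \<notin> order_ge n (Suc e)"
      using not_order_ge_mult[of f n 0 "xpow n e" e] xpow_order_ge by simp
    moreover have "f * xpow n e \<in> order_ge n e"
      using order_ge_mult[of f n 0 "xpow n e" e] xpow_order_ge by simp
    moreover have "g' \<notin> order_ge n 1" using fg'(3) by (simp add: denominators_def)
    ultimately have "f * xpow n e * g' \<notin> order_ge n (Suc e)"
      using not_order_ge_mult[of "f * xpow n e" n e g' 0] by simp
    moreover have "f' * g \<in> order_ge n (Suc e)"
      using order_ge_mult[OF fg'(2), of g 0] by simp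
    ultimately show False using eq by simp
  qed
  then show ?thesis unfolding fg(1) local_order_ge_def using fg by (intro localizedI) auto
qed

lemma one_notin_local_order_ge: "1 \<notin> local_order_ge n 1"
proof
  assume "1 \<in> local_order_ge n 1"
  then obtain f g where "1 = to_host f / to_host g" "f \<in> order_ge n 1" "g \<in> denominators"
    by (auto simp: localized_def local_order_ge_def)
  then show False by (auto simp: denominators_nonzero denominators_def)
qed

lemma to_host_xpow_notin: "to_host (xpow n e) \<notin> local_order_ge n (Suc e)"
  using local_order_ge_cancel_xpow[of 1 n e] localized_gap_algebra_closed(2) one_notin_local_order_ge
  by auto

lemma inverse_denominator: "g \<in> denominators \<Longrightarrow> 1 / to_host g \<in> localized gap_algebra"
  using localizedI[of 1 gap_algebra g] by simp

text \<open>Lowest-order terms are eliminated one at a time: if \<open>z i\<close> lies in the maximal ideal, its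
  term has order at least \<open>2 * Suc n\<close>, which exceeds all orders that occur here.\<close>

lemma independence_of_generators:
  assumes z: "\<And>i. i \<le> n \<Longrightarrow> z i \<in> localized gap_algebra"
    and sum: "(\<Sum>i\<le>n. z i * to_host (xpow n (Suc n + i))) = 0"
    and "i \<le> n"
  shows "z i \<in> local_order_ge n 1"
  using \<open>i \<le> n\<close>
proof (induction i rule: less_induct)
  case (less i)
  let ?t = "\<lambda>j. z j * to_host (xpow n (Suc n + j))"
  have "?t i + (\<Sum>j\<in>{..n} - {i}. ?t j) = 0"
    using sum less.prems by (simp add: sum.remove[of "{..n}" i])
  then have "?t i = - (\<Sum>j\<in>{..n} - {i}. ?t j)" by (simp add: eq_neg_iff_add_eq_0)
  also have "\<dots> \<in> local_order_ge n (Suc (Suc n + i))"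
  proof (intro local_order_ge_uminus local_order_ge_sum)
    fix j assume j: "j \<in> {..n} - {i}"
    have x: "to_host (xpow n (Suc n + j)) \<in> local_order_ge n (Suc n + j)" by (rule to_host_xpow) simp
    show "?t j \<in> local_order_ge n (Suc (Suc n + i))"
    proof (cases "j < i")
      case True
      then have "z j \<in> local_order_ge n (Suc n)"
        using less.IH[of j] j by (simp flip: local_order_ge_1)
      then have "?t j \<in> local_order_ge n (Suc n + (Suc n + j))"
        using x by (rule local_order_ge_mult)
      then show ?thesis
        using less.prems local_order_ge_antimono[of "Suc (Suc n + i)" "Suc n + (Suc n + j)" n] by auto
    next
      case False
      \<comment> \<open>Now \<open>j > i\<close>, and the factor \<open>xpow n (Suc n + j)\<close>
        alone has sufficient order.\<close>
      then have "?t j \<in> local_order_ge n (Suc n + j)"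
        using x z[of j] j by (intro local_order_ge_mult_left) auto
      then show ?thesis
        using False j local_order_ge_antimono[of "Suc (Suc n + i)" "Suc n + j" n] by auto
    qed
  qed
  finally show ?case using z less.prems by (intro local_order_ge_cancel_xpow)
qed


section \<open>Subrings of a type, and commutators\<close>

text \<open>Turns a subset of a type-class ring into a record, so that ideals and primes are
  available while calculations use the type-class operations.\<close>

definition ring_on :: "'a::comm_ring_1 set \<Rightarrow> 'a ring" where
  "ring_on L = \<lparr>carrier = L, monoid.mult = (*), monoid.one = 1, ring.zero = 0, ring.add = (+)\<rparr>"

lemma ring_on_simps [simp]:
  "carrier (ring_on L) = L" "x \<otimes>\<^bsub>ring_on L\<^esub> y = x * y" "\<one>\<^bsub>ring_on L\<^esub> = 1"
  "\<zero>\<^bsub>ring_on L\<^esub> = 0" "x \<oplus>\<^bsub>ring_on L\<^esub> y = x + y"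
  by (simp_all add: ring_on_def)

locale class_subring =
  fixes L :: "'a::idom set"
  assumes closed: "0 \<in> L" "1 \<in> L" "x \<in> L \<Longrightarrow> y \<in> L \<Longrightarrow> x + y \<in> L" "x \<in> L \<Longrightarrow> y \<in> L \<Longrightarrow> x * y \<in> L"
    "x \<in> L \<Longrightarrow> - x \<in> L"
begin

lemma domain_ring_on: "domain (ring_on L)"
proof -
  have "cring (ring_on L)"
  proof (rule cringI)
    show "abelian_group (ring_on L)"
      by (rule abelian_groupI) (auto simp: closed add_ac intro!: bexI[of _ "- x" for x] closed(5))
    show "comm_monoid (ring_on L)"
      by (rule comm_monoidI) (auto simp: closed mult_ac)
  qed (simp add: algebra_simps)
  then show ?thesis
    by (intro domain.intro domain_axioms.intro) auto
qed

sublocale R: domain "ring_on L"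
  by (rule domain_ring_on)

lemma a_inv_ring_on: "x \<in> L \<Longrightarrow> \<ominus>\<^bsub>ring_on L\<^esub> x = - x"
  using R.minus_equality[of "- x" x] closed by simp

lemma minus_ring_on: "x \<in> L \<Longrightarrow> y \<in> L \<Longrightarrow> x \<ominus>\<^bsub>ring_on L\<^esub> y = x - y"
  by (simp add: a_minus_def a_inv_ring_on)

lemma diff_closed: "x \<in> L \<Longrightarrow> y \<in> L \<Longrightarrow> x - y \<in> L"
  using closed(3)[of x "- y"] closed(5) by simp

lemma sum_closed: "(\<And>i. i \<in> I \<Longrightarrow> f i \<in> L) \<Longrightarrow> (\<Sum>i\<in>I. f i) \<in> L"
  by (induction I rule: infinite_finite_induct) (auto simp: closed)

lemma finsum_ring_on:
  "finite I \<Longrightarrow> (\<And>i. i \<in> I \<Longrightarrow> f i \<in> L) \<Longrightarrow> finsum (ring_on L) f I = (\<Sum>i\<in>I. f i)"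
  by (induction I rule: finite_induct) (auto simp: Pi_def sum_closed)

lemma ideal_ring_onI:
  assumes "I \<subseteq> L" "0 \<in> I" "\<And>x y. x \<in> I \<Longrightarrow> y \<in> I \<Longrightarrow> x + y \<in> I" "\<And>x y. x \<in> L \<Longrightarrow> y \<in> I \<Longrightarrow> x * y \<in> I"
  shows "ideal I (ring_on L)"
proof (rule idealI)
  show "ring (ring_on L)" by (rule R.ring_axioms)
  have "\<ominus>\<^bsub>ring_on L\<^esub> x \<in> I" if "x \<in> I" for x
  proof -
    have "x \<in> L" using that assms(1) by blast
    then have "\<ominus>\<^bsub>ring_on L\<^esub> x = - 1 * x" by (simp add: a_inv_ring_on)
    then show ?thesis using assms(4)[of "- 1" x] that closed by simp
  qed
  then show "subgroup I (add_monoid (ring_on L))"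
    using assms by (intro R.add.subgroupI) (auto simp flip: a_inv_def)
next
  fix a x assume "a \<in> I" "x \<in> carrier (ring_on L)"
  then show "x \<otimes>\<^bsub>ring_on L\<^esub> a \<in> I" "a \<otimes>\<^bsub>ring_on L\<^esub> x \<in> I"
    using assms(4)[of x a] by (simp_all add: mult.commute)
qed

end

text \<open>This is \<open>tr ([A, B] A) = tr (A B A) - tr (B A A)\<close>, which vanishes by cyclic
  invariance of the trace; the proof permutes the three summations.\<close>

lemma trace_commutator_mult_left:
  fixes A B :: "nat \<Rightarrow> nat \<Rightarrow> 'a::comm_ring_1"
  shows "(\<Sum>i<N. \<Sum>j<N. ((\<Sum>k<N. A i k * B k j) - (\<Sum>k<N. B i k * A k j)) * A j i) = 0"
proof -
  have "(\<Sum>i<N. \<Sum>j<N. (\<Sum>k<N. A i k * B k j) * A j i)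
      = (\<Sum>i<N. \<Sum>j<N. \<Sum>k<N. A j i * A i k * B k j)"
    by (simp add: sum_distrib_left mult_ac)
  also have "\<dots> = (\<Sum>j<N. \<Sum>i<N. \<Sum>k<N. A j i * A i k * B k j)"
    by (rule sum.swap)
  also have "\<dots> = (\<Sum>j<N. \<Sum>k<N. \<Sum>i<N. A j i * A i k * B k j)"
    by (intro sum.cong refl sum.swap)
  also have "\<dots> = (\<Sum>k<N. \<Sum>j<N. \<Sum>i<N. A j i * A i k * B k j)"
    by (rule sum.swap)
  also have "\<dots> = (\<Sum>i<N. \<Sum>j<N. (\<Sum>k<N. B i k * A k j) * A j i)"
    by (subst sum.swap, intro sum.cong refl) (simp add: sum_distrib_left sum_distrib_right mult_ac)
  finally show ?thesis by (simp add: left_diff_distrib sum_subtractf)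
qed

text \<open>Scalar matrices are central, so subtracting them does not affect commutators. Off the
  diagonal no \<open>k\<close> meets both corrections, hence no term \<open>a * b\<close> arises in
  the products.\<close>

lemma commutator_shift:
  fixes A B A' B' :: "nat \<Rightarrow> nat \<Rightarrow> 'a::comm_ring_1"
  assumes "i < N" "j < N" "i \<noteq> j"
    and A': "\<And>i j. A' i j = A i j - (if i = j then a else 0)"
    and B': "\<And>i j. B' i j = B i j - (if i = j then b else 0)"
  shows "(\<Sum>k<N. A' i k * B' k j) - (\<Sum>k<N. B' i k * A' k j) =
    (\<Sum>k<N. A i k * B k j) - (\<Sum>k<N. B i k * A k j)"
proof -
  have shift: "(\<Sum>k<N. (A i k - (if i = k then a else 0)) * (B k j - (if k = j then b else 0))) =
      (\<Sum>k<N. A i k * B k j) - a * B i j - A i j * b"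
    for A B :: "nat \<Rightarrow> nat \<Rightarrow> 'a" and a b
  proof -
    have "(\<Sum>k<N. (A i k - (if i = k then a else 0)) * (B k j - (if k = j then b else 0))) =
       (\<Sum>k<N. A i k * B k j - (if i = k then a * B i j else 0) - (if k = j then A i j * b else 0))"
      using assms(3) by (intro sum.cong) (auto simp: algebra_simps)
    also have "\<dots> = (\<Sum>k<N. A i k * B k j) - a * B i j - A i j * b"
      using assms(1,2) by (simp add: sum_subtractf)
    finally show ?thesis .
  qed
  show ?thesis unfolding A' B' shift by (simp add: algebra_simps)
qed

text \<open>Row-major numbering of matrix positions, by which a sum over generators of
  \<open>M\<^sub>n\<close> becomes a sum over entries.\<close>

lemma sum_square_reindex:
  fixes f :: "nat \<Rightarrow> 'a::comm_monoid_add"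
  shows "(\<Sum>k<N * N. f k) = (\<Sum>i<N. \<Sum>j<N. f (j + i * N))"
proof -
  have "(\<Sum>i<N. \<Sum>j<N. f (j + i * N)) = (\<Sum>i<N. sum f {i * N..<i * N + N})"
  proof (rule sum.cong[OF refl])
    fix i show "(\<Sum>j<N. f (j + i * N)) = sum f {i * N..<i * N + N}"
      using sum.shift_bounds_nat_ivl[of f 0 "i * N" N] by (simp add: lessThan_atLeast0 add.commute)
  qed
  then show ?thesis by (simp add: sum.nat_group)
qed


section \<open>Maximal ideals\<close>

abbreviation gap_ring :: "host set" where
  "gap_ring \<equiv> localized gap_algebra"

interpretation gap_ring: class_subring gap_ring
  by unfold_locales (rule localized_gap_algebra_closed; assumption?)+

lemma ideal_local_order_ge: "ideal (local_order_ge n e) (ring_on gap_ring)"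
  by (intro gap_ring.ideal_ring_onI local_order_ge_subset zero_local_order_ge)
     (auto intro: local_order_ge_add local_order_ge_mult_left)

text \<open>The witness is \<open>t = x\<^sub>l^(l + 1) * x\<^sub>n^(n + 1)\<close> for an indeterminate \<open>x\<^sub>l\<close> that does not occur in \<open>f\<close>.\<close>

lemma unit_modulo_maximal:
  assumes "f \<in> gap_algebra" "f \<notin> order_ge n 1"
  obtains t where "t \<in> gap_algebra \<inter> order_ge n 1" "f + t \<in> denominators"
proof -
  define V where "V = insert n (\<Union>m\<in>monomials f. Poly_Mapping.keys m)"
  have "finite V" by (simp add: V_def)
  then obtain l where l: "l \<notin> V" using ex_new_if_finite infinite_UNIV_nat by blast
  define t where "t = xpow l (Suc l) * xpow n (Suc n)"
  define m0 where "m0 = Poly_Mapping.single l (Suc l) + Poly_Mapping.single n (Suc n)"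
  have t: "t = Poly_Mapping.single m0 1" by (simp add: t_def m0_def mult_single)
  have tA: "t \<in> gap_algebra" unfolding t_def by (intro gap_algebra_mult xpow_gap_algebra) auto
  have tn: "t \<in> order_ge n 1" unfolding t by (simp add: order_ge_def m0_def lookup_add)
  have ml: "exponent m l = 0" if "m \<in> monomials f" for m
    using l that by (auto simp: V_def in_keys_iff)
  have m0_l: "exponent m0 l \<noteq> 0" by (simp add: m0_def lookup_add)
  then have m0f: "m0 \<notin> monomials f" using ml[of m0] by (rule contrapos_nn)
  have m0_other: "exponent m0 k = 0" if "k \<noteq> n" "k \<noteq> l" for k
    using that by (simp add: m0_def lookup_add lookup_single)
  have lookup_ft: "Poly_Mapping.lookup (f + t) m = Poly_Mapping.lookup f m + (if m = m0 then 1 else 0)" for m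
    by (simp add: t lookup_add lookup_single when_def eq_commute)
  have keys_f: "m \<in> monomials (f + t)" if "m \<in> monomials f" for m
  proof -
    have "m \<noteq> m0" using that m0f by blast
    then show ?thesis using that lookup_ft[of m] by (simp add: in_keys_iff)
  qed
  have "Poly_Mapping.lookup f m0 = 0" using m0f by (simp add: in_keys_iff)
  then have key_m0: "m0 \<in> monomials (f + t)" using lookup_ft[of m0] by (simp add: in_keys_iff)
  obtain mn where mn: "mn \<in> monomials f" "exponent mn n = 0"
    using assms(2) by (auto simp: order_ge_def)
  \<comment> \<open>The monomial \<open>mn\<close> of \<open>f\<close> is free of
    \<open>x\<^sub>n\<close> and \<open>x\<^sub>l\<close>, which settles \<open>k = n\<close> and
    \<open>k = l\<close>; the monomial \<open>m0\<close> of \<open>t\<close> contains only these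
    two, which settles all other \<open>k\<close>.\<close>
  have "f + t \<notin> order_ge k 1" for k
  proof (cases "k = n \<or> k = l")
    case True
    then have "exponent mn k = 0" using mn(2) ml[OF mn(1)] by auto
    then show ?thesis using keys_f[OF mn(1)] by (auto simp: order_ge_def intro!: bexI[of _ mn])
  next
    case False
    then show ?thesis using key_m0 m0_other[of k] by (auto simp: order_ge_def intro!: bexI[of _ m0])
  qed
  then have "f + t \<in> denominators"
    using gap_algebra_add[OF assms(1) tA] by (simp add: denominators_def)
  then show thesis using tA tn by (intro that[of t]) auto
qed

text \<open>An ideal strictly above \<open>M\<^sub>n\<close> contains a numerator of order 0; adding
  a suitable element of \<open>M\<^sub>n\<close> turns it into a denominator, that is, a
  unit.\<close>

lemma maximalideal_local_order_ge: "maximalideal (local_order_ge n 1) (ring_on gap_ring)"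
proof (rule maximalidealI)
  show "ideal (local_order_ge n 1) (ring_on gap_ring)" by (rule ideal_local_order_ge)
  show "carrier (ring_on gap_ring) \<noteq> local_order_ge n 1"
    using one_notin_local_order_ge localized_gap_algebra_closed(2) by auto
  fix J assume J: "ideal J (ring_on gap_ring)" "local_order_ge n 1 \<subseteq> J" "J \<subseteq> carrier (ring_on gap_ring)"
  interpret J: ideal J "ring_on gap_ring" by fact
  show "J = local_order_ge n 1 \<or> J = carrier (ring_on gap_ring)"
  proof (cases "J = local_order_ge n 1")
    case False
    then obtain b where b: "b \<in> J" "b \<notin> local_order_ge n 1" using J(2) by blast
    then have "b \<in> gap_ring" using J(3) by auto
    then obtain f g where fg: "b = to_host f / to_host g" "f \<in> gap_algebra" "g \<in> denominators"
      by (auto simp: localized_def)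
    have "f \<notin> order_ge n 1"
      using b(2) fg by (auto simp: local_order_ge_def intro: localizedI)
    then obtain t where t: "t \<in> gap_algebra \<inter> order_ge n 1" "f + t \<in> denominators"
      using unit_modulo_maximal fg(2) by blast
    have "to_host g * b \<in> J"
      using J.I_l_closed[OF b(1), of "to_host g"] fg(3)
      by (simp add: localized_to_host denominators_gap)
    then have "to_host f \<in> J" using fg(1,3) by (simp add: denominators_nonzero)
    moreover have "to_host t \<in> J"
      using J(2) localized_to_host[OF t(1)] by (auto simp: local_order_ge_def)
    ultimately have "to_host (f + t) \<in> J" using J.a_closed by simp
    then have "1 / to_host (f + t) * to_host (f + t) \<in> J"
      using J.I_l_closed[of "to_host (f + t)" "1 / to_host (f + t)"] inverse_denominator[OF t(2)]
      by simp
    moreover have "to_host (f + t) \<noteq> 0" using t(2) denominators_nonzero to_host_eq_0_iff by blast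
    ultimately have "1 \<in> J" by simp
    then show ?thesis using J.one_imp_carrier by simp
  qed simp
qed

text \<open>Each single monomial of a numerator in \<open>M\<^sub>n\<close> is one of these
  generators times a monomial of the algebra.\<close>

lemma local_order_ge_finitely_generated:
  "local_order_ge n 1 = genideal (ring_on gap_ring) ((\<lambda>i. to_host (xpow n (Suc n + i))) ` {..n})"
    (is "_ = genideal _ ?G")
proof
  have xL: "to_host (xpow n (Suc n + i)) \<in> local_order_ge n 1" for i
    using to_host_xpow[of n "Suc n + i"] local_order_ge_antimono[of 1 "Suc n + i" n] by auto
  have G: "?G \<subseteq> carrier (ring_on gap_ring)" using xL local_order_ge_subset by auto
  show "genideal (ring_on gap_ring) ?G \<subseteq> local_order_ge n 1"
    using xL by (intro gap_ring.R.genideal_minimal ideal_local_order_ge) auto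
  interpret I: ideal "genideal (ring_on gap_ring) ?G" "ring_on gap_ring"
    by (rule gap_ring.R.genideal_ideal[OF G])
  show "local_order_ge n 1 \<subseteq> genideal (ring_on gap_ring) ?G"
  proof
    fix z assume "z \<in> local_order_ge n 1"
    then obtain f g where fg: "z = to_host f / to_host g" "f \<in> gap_algebra" "f \<in> order_ge n 1"
      "g \<in> denominators" by (auto simp: localized_def local_order_ge_def)
    have mono: "to_host (Poly_Mapping.single m (Poly_Mapping.lookup f m)) \<in> genideal (ring_on gap_ring) ?G"
      if m: "m \<in> monomials f" for m
    proof -
      have m_n: "Suc n \<le> exponent m n"
        using gap_algebra_order_ge[OF fg(2,3)] m by (auto simp: order_ge_def)
      \<comment> \<open>An exponent up to \<open>2 * n + 1\<close> is removed entirely; from a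
        larger one \<open>Suc n\<close> is subtracted, which leaves at least \<open>Suc n\<close>.
        Either way the cofactor respects the gap.\<close>
      define i where "i = (if exponent m n \<le> Suc n + n then exponent m n - Suc n else 0)"
      define m' where "m' = m - Poly_Mapping.single n (Suc n + i)"
      have i: "i \<le> n" by (auto simp: i_def)
      have m: "m = Poly_Mapping.single n (Suc n + i) + m'"
        using m_n by (intro poly_mapping_eqI)
          (auto simp: m'_def i_def lookup_add lookup_minus lookup_single when_def)
      have "Poly_Mapping.single m' (Poly_Mapping.lookup f m) \<in> gap_algebra"
        using fg(2) \<open>m \<in> monomials f\<close> m_n
        by (auto simp: gap_algebra_def m'_def i_def lookup_minus lookup_single when_def)
      then have "to_host (Poly_Mapping.single m' (Poly_Mapping.lookup f m)) \<in> gap_ring"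
        by (rule localized_to_host)
      moreover have "to_host (xpow n (Suc n + i)) \<in> genideal (ring_on gap_ring) ?G"
        using gap_ring.R.genideal_self[OF G] i by blast
      ultimately have "to_host (xpow n (Suc n + i)) * to_host (Poly_Mapping.single m' (Poly_Mapping.lookup f m))
          \<in> genideal (ring_on gap_ring) ?G"
        using I.I_r_closed by simp
      also have "to_host (xpow n (Suc n + i)) * to_host (Poly_Mapping.single m' (Poly_Mapping.lookup f m))
          = to_host (Poly_Mapping.single m (Poly_Mapping.lookup f m))"
        unfolding to_host_simps(4)[symmetric] mult_single m[symmetric] by simp
      finally show ?thesis .
    qed
    have sums: "(\<Sum>i\<in>S. x i) \<in> genideal (ring_on gap_ring) ?G"
      if "finite S" "\<And>i. i \<in> S \<Longrightarrow> x i \<in> genideal (ring_on gap_ring) ?G" for S and x :: "'i \<Rightarrow> host"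
      using that I.zero_closed I.a_closed by (induction S rule: finite_induct) auto
    have "to_host f = (\<Sum>m\<in>monomials f. to_host (Poly_Mapping.single m (Poly_Mapping.lookup f m)))"
      by (simp add: sum_singles flip: to_host_sum)
    also have "\<dots> \<in> genideal (ring_on gap_ring) ?G" using mono by (intro sums) auto
    finally have "1 / to_host g * to_host f \<in> genideal (ring_on gap_ring) ?G"
      using I.I_l_closed[of "to_host f" "1 / to_host g"] inverse_denominator[OF fg(4)] by simp
    then show "z \<in> genideal (ring_on gap_ring) ?G" by (simp add: fg(1))
  qed
qed


section \<open>Nonzero primes are maximal\<close>

lemma order_ge_power: "f \<in> order_ge n 1 \<Longrightarrow> f ^ k \<in> order_ge n k"
  using order_ge_mult[of f n 1 _ _] by (induction k) auto

text \<open>For \<open>n < q\<close> a nonzero multiple of \<open>q\<close> is at least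
  \<open>q\<close>, hence beyond the gap; at indices from \<open>q\<close> on, divisibility by
  \<open>0\<close> makes the exponent vanish.\<close>

lemma gap_algebra_if_exponents_dvd:
  assumes "\<And>m n. m \<in> monomials f \<Longrightarrow> (if n < q then q else 0) dvd exponent m n"
  shows "f \<in> gap_algebra"
  unfolding gap_algebra_def
proof (intro CollectI ballI allI impI)
  fix m n assume m: "m \<in> monomials f" "exponent m n \<noteq> 0"
  then have "n < q" "q dvd exponent m n" using assms[OF m(1), of n] by (auto split: if_splits)
  then show "n < exponent m n" using m(2) by (meson dvd_imp_le gr0I less_le_trans)
qed

text \<open>The norm of a numerator in \<open>P\<close> is an element of \<open>P\<close> with
  exponents divisible by \<open>q\<close>. It is no denominator, as those are units, so some
  \<open>x\<^sub>n\<close> and hence \<open>x\<^sub>n^q\<close> divides it, and the cofactor has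
  exponents of the same kind. By primality the power or the cofactor lies in \<open>P\<close>, and
  the argument repeats with the cofactor.\<close>

lemma prime_contains_power_of_indeterminate:
  assumes P: "primeideal P (ring_on gap_ring)" "P \<noteq> {0}"
  obtains n q where "n < q" "to_host (xpow n q) \<in> P"
proof -
  interpret P: primeideal P "ring_on gap_ring" by fact
  have prime: "to_host f \<in> P \<or> to_host h \<in> P"
    if "to_host (f * h) \<in> P" "f \<in> gap_algebra" "h \<in> gap_algebra" for f h
    using P.I_prime[of "to_host f" "to_host h"] that by (simp add: localized_to_host)
  have one: "1 \<notin> P" using P.one_imp_carrier P.I_notcarr by auto
  have unit: "to_host g \<notin> P" if "g \<in> denominators" for g
  proof
    assume "to_host g \<in> P"
    then have "1 / to_host g * to_host g \<in> P"
      using P.I_l_closed[of "to_host g" "1 / to_host g"] inverse_denominator[OF that] by simp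
    then show False using one denominators_nonzero[OF that] by simp
  qed
  have "\<exists>z\<in>P. z \<noteq> 0" using P(2) P.zero_closed by auto
  then obtain z where z: "z \<in> P" "z \<noteq> 0" by blast
  then obtain f g where fg: "z = to_host f / to_host g" "f \<in> gap_algebra" "g \<in> denominators"
    using P.Icarr[OF z(1)] by (auto simp: localized_def)
  have "to_host g * z \<in> P"
    using P.I_l_closed[OF z(1), of "to_host g"] fg(3) by (simp add: localized_to_host denominators_gap)
  then have fP: "to_host f \<in> P" using fg(1,3) by (simp add: denominators_nonzero)
  have "f \<noteq> 0" using z(2) fg(1) by auto
  then obtain h q where h: "h \<in> gap_algebra" "f * h \<noteq> 0" "q > 0"
    "\<And>m n. m \<in> monomials (f * h) \<Longrightarrow> (if n < q then q else 0) dvd exponent m n"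
    using norm_in_all_variables[OF fg(2)] by metis
  have "to_host (f * h) \<in> P"
    using P.I_r_closed[OF fP, of "to_host h"] h(1) by (simp add: localized_to_host)
  moreover have "\<exists>n<q. to_host (xpow n q) \<in> P"
    if "m0 \<in> monomials F" "to_host F \<in> P"
      "\<And>m n. m \<in> monomials F \<Longrightarrow> (if n < q then q else 0) dvd exponent m n" for F m0
    using that
  \<comment> \<open>One monomial is followed through the divisions; each passage to a cofactor
    lowers its exponent sum, so the process ends.\<close>
  proof (induction "\<Sum>k<q. exponent m0 k" arbitrary: F m0 rule: less_induct)
    case less
    have F: "F \<in> gap_algebra" using less.prems(3) by (rule gap_algebra_if_exponents_dvd)
    then have "\<exists>n. F \<in> order_ge n 1"
      using unit[of F] less.prems(2) by (auto simp: denominators_def)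
    then obtain n where n: "F \<in> order_ge n 1" by blast
    have big: "n < q \<and> q \<le> exponent m n" if "m \<in> monomials F" for m
    proof -
      have "exponent m n > 0" using n that by (force simp: order_ge_def)
      moreover have "(if n < q then q else 0) dvd exponent m n" using less.prems(3) that by blast
      ultimately show ?thesis by (auto split: if_splits dest: dvd_imp_le)
    qed
    then have nq: "n < q" using less.prems(1) by blast
    have "F \<in> order_ge n q" using big by (auto simp: order_ge_def)
    then obtain H where H: "F = xpow n q * H"
      "monomials F = (\<lambda>m. Poly_Mapping.single n q + m) ` monomials H" by (rule xpow_dvd)
    have H_dvd: "(if k < q then q else 0) dvd exponent m k" if "m \<in> monomials H" for m k
    proof -
      have "Poly_Mapping.single n q + m \<in> monomials F" using H(2) that by blast
      from less.prems(3)[OF this, of k] show ?thesis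
        using nq by (cases "k = n") (auto simp: lookup_add lookup_single)
    qed
    have H_gap: "H \<in> gap_algebra" using H_dvd by (rule gap_algebra_if_exponents_dvd)
    obtain m1 where m1: "m1 \<in> monomials H" "m0 = Poly_Mapping.single n q + m1"
      using less.prems(1) H(2) by blast
    consider "to_host (xpow n q) \<in> P" | "to_host H \<in> P"
      using prime[of "xpow n q" H] less.prems(2) H(1) H_gap nq xpow_gap_algebra by blast
    then show ?case
    proof cases
      case 2
      have "(\<Sum>k<q. exponent m1 k) < (\<Sum>k<q. exponent m0 k)"
        using nq by (intro sum_strict_mono_ex1) (auto simp: m1(2) lookup_add intro!: bexI[of _ n])
      then show ?thesis using less.hyps m1(1) 2 H_dvd by blast
    qed (use nq in blast)
  qed
  moreover obtain m0 where "m0 \<in> monomials (f * h)"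
    using h(2) by (metis keys_eq_empty ex_in_conv)
  ultimately show thesis using h(4) that by blast
qed

text \<open>A high power of a numerator in \<open>M\<^sub>n\<close> is \<open>xpow n q\<close> times
  an element of the algebra, hence lies in \<open>P\<close>; primality brings the numerator itself
  into \<open>P\<close>.\<close>

lemma maximal_subset_nonzero_prime:
  assumes P: "primeideal P (ring_on gap_ring)" "P \<noteq> {0}"
  obtains n where "local_order_ge n 1 \<subseteq> P"
proof -
  interpret P: primeideal P "ring_on gap_ring" by fact
  have one: "1 \<notin> P" using P.one_imp_carrier P.I_notcarr by auto
  have root: "x \<in> P" if "x ^ k \<in> P" "x \<in> gap_ring" for x k
    using that(1)
  proof (induction k)
    case (Suc k)
    have "x ^ k \<in> gap_ring" by (induction k) (auto intro: gap_ring.closed that(2))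
    then show ?case using Suc P.I_prime[of x "x ^ k"] that(2) by auto
  qed (use one in simp)
  obtain n q where nq: "n < q" "to_host (xpow n q) \<in> P"
    using prime_contains_power_of_indeterminate[OF P] by blast
  have "local_order_ge n 1 \<subseteq> P"
  proof
    fix z assume "z \<in> local_order_ge n 1"
    then obtain f g where fg: "z = to_host f / to_host g" "f \<in> gap_algebra" "f \<in> order_ge n 1"
      "g \<in> denominators" by (auto simp: localized_def local_order_ge_def)
    \<comment> \<open>The exponent \<open>2 * q\<close> ensures that division by
      \<open>xpow n q\<close> leaves order at least \<open>q > n\<close>, so that the cofactor
      respects the gap at \<open>n\<close>.\<close>
    have f2: "f ^ (2 * q) \<in> order_ge n (2 * q)" by (rule order_ge_power[OF fg(3)])
    then have "f ^ (2 * q) \<in> order_ge n q" by (rule order_ge_antimono[rotated]) simp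
    then obtain H where H: "f ^ (2 * q) = xpow n q * H"
      "monomials (f ^ (2 * q)) = (\<lambda>m. Poly_Mapping.single n q + m) ` monomials H" by (rule xpow_dvd)
    have "H \<in> gap_algebra" unfolding gap_algebra_def
    proof (intro CollectI ballI allI impI)
      fix m k assume m: "m \<in> monomials H" "exponent m k \<noteq> 0"
      then have m': "Poly_Mapping.single n q + m \<in> monomials (f ^ (2 * q))" using H(2) by blast
      show "k < exponent m k"
      proof (cases "k = n")
        case True
        have "2 * q \<le> exponent (Poly_Mapping.single n q + m) n"
          using f2 m' unfolding order_ge_def by blast
        then show ?thesis using True nq(1) by (simp add: lookup_add)
      next
        case False
        then have "exponent (Poly_Mapping.single n q + m) k = exponent m k"
          by (simp add: lookup_add lookup_single)
        moreover have "f ^ (2 * q) \<in> gap_algebra" by (rule gap_algebra_power[OF fg(2)])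
        ultimately show ?thesis
          using m' m(2) unfolding gap_algebra_def by (metis (mono_tags, lifting) mem_Collect_eq)
      qed
    qed
    then have "to_host (f ^ (2 * q)) \<in> P"
      using P.I_r_closed[OF nq(2), of "to_host H"] H(1) by (simp add: localized_to_host)
    then have "to_host f \<in> P"
      using root[of "to_host f" "2 * q"] fg(2) by (simp add: to_host_power localized_to_host)
    then have "1 / to_host g * to_host f \<in> P"
      using P.I_l_closed[of "to_host f" "1 / to_host g"] inverse_denominator[OF fg(4)] by simp
    then show "z \<in> P" by (simp add: fg(1))
  qed
  then show thesis by (rule that)
qed

lemma nonzero_prime_eq_maximal:
  assumes P: "primeideal P (ring_on gap_ring)" "P \<noteq> {0}"
  obtains n where "P = local_order_ge n 1"
proof -
  interpret P: primeideal P "ring_on gap_ring" by fact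
  obtain n where n: "local_order_ge n 1 \<subseteq> P" using maximal_subset_nonzero_prime[OF P] by blast
  interpret M: maximalideal "local_order_ge n 1" "ring_on gap_ring" by (rule maximalideal_local_order_ge)
  have "P = local_order_ge n 1"
    using M.I_maximal[OF P.is_ideal n P.a_subset] P.I_notcarr by blast
  then show thesis by (rule that)
qed

section \<open>The Noetherian property and the dimension\<close>

lemma noetherian_domain_localization: "noetherian_domain (ring_on gap_ring)"
proof (intro noetherian_domain.intro gap_ring.R.noetherian_ring_if_primes_finitely_generated gap_ring.domain_ring_on)
  fix P assume P: "primeideal P (ring_on gap_ring)"
  show "\<exists>A\<subseteq>carrier (ring_on gap_ring). finite A \<and> P = genideal (ring_on gap_ring) A"
  proof (cases "P = {0}")
    case True
    then show ?thesis
      using gap_ring.R.genideal_zero gap_ring.closed(1) by (intro exI[of _ "{0}"]) simp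
  next
    case False
    then obtain n where n: "P = local_order_ge n 1" using nonzero_prime_eq_maximal[OF P] by blast
    have "to_host (xpow n (Suc n + i)) \<in> gap_ring" for i
      by (intro localized_to_host xpow_gap_algebra) simp
    then show ?thesis
      unfolding n using local_order_ge_finitely_generated[of n]
      by (intro exI[of _ "(\<lambda>i. to_host (xpow n (Suc n + i))) ` {..n}"]) auto
  qed
qed

lemma krull_dim_localization: "krull_dim (ring_on gap_ring) = 1"
proof (rule gap_ring.R.krull_dim_1I)
  fix P assume "primeideal P (ring_on gap_ring)" "P \<noteq> {\<zero>\<^bsub>ring_on gap_ring\<^esub>}"
  then show "maximalideal P (ring_on gap_ring)"
    using nonzero_prime_eq_maximal[of P] maximalideal_local_order_ge by auto
next
  show "primeideal (local_order_ge 0 1) (ring_on gap_ring)"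
    by (rule gap_ring.R.maximalideal_prime[OF maximalideal_local_order_ge])
  have "to_host (xpow 0 1) \<noteq> 0" using to_host_eq_0_iff by (metis keys_eq_empty keys_single insert_not_empty one_neq_zero)
  moreover have "to_host (xpow 0 1) \<in> local_order_ge 0 1" by (rule to_host_xpow) simp
  ultimately show "local_order_ge 0 1 \<noteq> {\<zero>\<^bsub>ring_on gap_ring\<^esub>}" by auto
qed


section \<open>A matrix that is not a commutator\<close>

text \<open>With \<open>n = N * N - 1\<close> the ideal \<open>M\<^sub>n\<close> has one generator
  \<open>y i j\<close> for each matrix position, and subtracting the diagonal sum at position
  \<open>(0, 0)\<close> makes \<open>C\<close> traceless.\<close>

lemma not_commutator:
  fixes A B C :: "nat \<Rightarrow> nat \<Rightarrow> host" and N :: nat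
  defines "n \<equiv> N * N - 1"
  defines "y \<equiv> \<lambda>i j. to_host (xpow n (Suc n + (j + i * N)))"
  assumes N: "N \<ge> 2"
    and AB: "\<And>i j. i < N \<Longrightarrow> j < N \<Longrightarrow> A i j \<in> gap_ring" "\<And>i j. i < N \<Longrightarrow> j < N \<Longrightarrow> B i j \<in> gap_ring"
    and C: "\<And>i j. C i j = y i j - (if i = 0 \<and> j = 0 then \<Sum>l<N. y l l else 0)"
    and comm: "\<And>i j. i < N \<Longrightarrow> j < N \<Longrightarrow> C i j = (\<Sum>k<N. A i k * B k j) - (\<Sum>k<N. B i k * A k j)"
  shows False
proof -
  have "2 * 2 \<le> N * N" using N by (intro mult_le_mono)
  then have n: "{..n} = {..<N * N}" "n \<ge> 1" by (auto simp: n_def)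
  \<comment> \<open>A relation \<open>tr (C U) = 0\<close> makes \<open>U\<close> scalar modulo
    \<open>M\<^sub>n\<close>: the coefficient of \<open>y i j\<close> in it is \<open>U j i\<close>,
    diminished by \<open>U 0 0\<close> on the diagonal because of the corrected entry, and
    independence puts all coefficients into \<open>M\<^sub>n\<close>.\<close>
  have scalar: "U j i - (if j = i then U 0 0 else 0) \<in> local_order_ge n 1"
    if ij: "i < N" "j < N" and U: "\<And>i j. i < N \<Longrightarrow> j < N \<Longrightarrow> U i j \<in> gap_ring"
      and tr: "(\<Sum>i<N. \<Sum>j<N. C i j * U j i) = 0" for U i j
  proof -
    \<comment> \<open>The coefficient of generator number \<open>k = j + i * N\<close>, so that
      \<open>j = k mod N\<close> and \<open>i = k div N\<close>.\<close>
    define z where "z k = (if k < N * N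
        then U (k mod N) (k div N) - (if k mod N = k div N then U 0 0 else 0) else 0)" for k
    have zij: "z (j + i * N) = U j i - (if j = i then U 0 0 else 0)" if "i < N" "j < N" for i j
    proof -
      have "j + i * N < Suc i * N" using that by simp
      also have "\<dots> \<le> N * N" using that by (intro mult_le_mono) auto
      finally show ?thesis using that by (simp add: z_def)
    qed
    have "(\<Sum>i<N. \<Sum>j<N. z (j + i * N) * y i j) =
        (\<Sum>i<N. \<Sum>j<N. y i j * U j i - (if j = i then U 0 0 * y i i else 0))"
      by (intro sum.cong refl) (auto simp: zij algebra_simps)
    also have "\<dots> = (\<Sum>i<N. \<Sum>j<N. y i j * U j i) - U 0 0 * (\<Sum>l<N. y l l)"
      by (simp add: sum_subtractf sum_distrib_left)
    \<comment> \<open>The correction is written as a double sum supported at \<open>(0, 0)\<close>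
      so that it can be subtracted entry by entry.\<close>
    also have "U 0 0 * (\<Sum>l<N. y l l) =
        (\<Sum>i<N. if i = 0 then (\<Sum>j<N. if j = 0 then U 0 0 * (\<Sum>l<N. y l l) else 0) else 0)"
      using N by simp
    also have "(\<Sum>i<N. \<Sum>j<N. y i j * U j i) - \<dots> = (\<Sum>i<N. \<Sum>j<N. C i j * U j i)"
    proof -
      have "C i j * U j i = y i j * U j i -
          (if i = 0 then if j = 0 then U 0 0 * (\<Sum>l<N. y l l) else 0 else 0)" for i j
        by (simp add: C left_diff_distrib right_diff_distrib mult.commute)
      then show ?thesis
        unfolding sum_subtractf[symmetric] by (intro sum.cong refl) (simp add: sum_subtractf)
    qed
    finally have "(\<Sum>i<N. \<Sum>j<N. z (j + i * N) * y i j) = 0" using tr by simp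
    then have "(\<Sum>k\<le>n. z k * to_host (xpow n (Suc n + k))) = 0"
      unfolding n(1) sum_square_reindex y_def .
    moreover have "z k \<in> gap_ring" for k
    proof (cases "k < N * N")
      case True
      then have "k mod N < N" "k div N < N" using N by (auto simp: less_mult_imp_div_less)
      then have "U (k mod N) (k div N) \<in> gap_ring" "U 0 0 \<in> gap_ring" using U N by auto
      then show ?thesis using True by (simp add: z_def gap_ring.closed(1) gap_ring.diff_closed)
    qed (simp add: z_def gap_ring.closed)
    moreover have "j + i * N \<le> n"
    proof -
      have "j + i * N < Suc i * N" using ij by simp
      also have "\<dots> \<le> N * N" using ij by (intro mult_le_mono) auto
      finally show ?thesis by (simp add: n_def)
    qed
    ultimately have "z (j + i * N) \<in> local_order_ge n 1" by (intro independence_of_generators)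
    then show ?thesis using zij[OF ij] by simp
  qed
  \<comment> \<open>Subtracting these scalars moves all entries of both matrices into
    \<open>M\<^sub>n\<close>.\<close>
  define A' where "A' i j = A i j - (if i = j then A 0 0 else 0)" for i j
  define B' where "B' i j = B i j - (if i = j then B 0 0 else 0)" for i j
  have "(\<Sum>i<N. \<Sum>j<N. C i j * A j i) = 0"
    using trace_commutator_mult_left[of A B N] by (simp add: comm)
  then have A': "A' i j \<in> local_order_ge n (Suc n)" if "i < N" "j < N" for i j
    using scalar[of j i A] AB(1) that by (simp add: A'_def flip: local_order_ge_1)
  \<comment> \<open>As \<open>- C\<close> is the commutator \<open>[B, A]\<close>, the trace
    identity applies with the roles exchanged.\<close>
  have "(\<Sum>i<N. \<Sum>j<N. - C i j * B j i) = 0"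
    using trace_commutator_mult_left[of B A N] by (simp add: comm)
  then have B': "B' i j \<in> local_order_ge n (Suc n)" if "i < N" "j < N" for i j
    using scalar[of j i B] AB(2) that by (simp add: B'_def sum_negf flip: local_order_ge_1)
  have "C 0 1 = (\<Sum>k<N. A' 0 k * B' k 1) - (\<Sum>k<N. B' 0 k * A' k 1)"
    using comm[of 0 1] commutator_shift[of 0 N 1 A' A "A 0 0" B' B "B 0 0"] N by (simp add: A'_def B'_def)
  also have "\<dots> = (\<Sum>k<N. A' 0 k * B' k 1) + - (\<Sum>k<N. B' 0 k * A' k 1)" by simp
  also have "\<dots> \<in> local_order_ge n (Suc n + Suc n)"
    using N by (intro local_order_ge_add local_order_ge_uminus local_order_ge_sum local_order_ge_mult A' B') auto
  \<comment> \<open>For \<open>n \<ge> 1\<close> the order \<open>2 * Suc n\<close> exceeds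
    \<open>Suc n + 1\<close>, the order of \<open>C 0 1\<close>.\<close>
  also have "\<dots> \<subseteq> local_order_ge n (Suc (Suc n + 1))"
    using n(2) by (intro local_order_ge_antimono) simp
  finally have "to_host (xpow n (Suc n + 1)) \<in> local_order_ge n (Suc (Suc n + 1))"
    by (simp add: C y_def)
  then show False using to_host_xpow_notin by blast
qed

theorem theorem5p2:
  shows "\<exists>\<Lambda> :: host ring. noetherian_domain \<Lambda> \<and> krull_dim \<Lambda> = 1 \<and>
    (\<forall>n\<ge>2. \<exists>C\<in>carrier (matrix_ring \<Lambda> n).
       matrix_trace \<Lambda> n C = \<zero>\<^bsub>\<Lambda>\<^esub> \<and> \<not> is_commutator (matrix_ring \<Lambda> n) C)"
proof (intro exI[of _ "ring_on gap_ring"] conjI allI impI noetherian_domain_localization krull_dim_localization)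
  fix N :: nat assume N: "N \<ge> 2"
  \<comment> \<open>One ring serves all sizes: size \<open>N\<close> is handled at the maximal ideal
    \<open>M\<^sub>n\<close> whose listed generators number exactly \<open>N * N\<close>.\<close>
  define n where "n = N * N - 1"
  define y where "y i j = to_host (xpow n (Suc n + (j + i * N)))" for i j
  define C where "C i j = y i j - (if i = 0 \<and> j = 0 then \<Sum>l<N. y l l else 0)" for i j
  let ?R = "ring_on gap_ring" and ?M = "matrix_ring (ring_on gap_ring) N"
  define D where "D = (\<lambda>(i, j)\<in>{..<N} \<times> {..<N}. C i j)"
  have y: "y i j \<in> gap_ring" for i j
    unfolding y_def by (intro localized_to_host xpow_gap_algebra) simp
  have CL: "C i j \<in> gap_ring" for i j
    unfolding C_def using y by (intro gap_ring.diff_closed) (simp_all add: gap_ring.closed(1) gap_ring.sum_closed)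
  have DM: "D \<in> carrier ?M" by (auto simp: matrix_ring_def D_def CL)
  have "matrix_trace ?R N D = (\<Sum>i<N. C i i)"
    unfolding matrix_trace_def by (subst gap_ring.finsum_ring_on) (auto simp: D_def CL)
  also have "\<dots> = 0" using N by (simp add: C_def sum_subtractf)
  finally have trace: "matrix_trace ?R N D = \<zero>\<^bsub>?R\<^esub>" by simp
  moreover have "\<not> is_commutator ?M D"
  proof
    assume "is_commutator ?M D"
    then obtain A B where AB: "A \<in> carrier ?M" "B \<in> carrier ?M"
      and D: "D = A \<otimes>\<^bsub>?M\<^esub> B \<ominus>\<^bsub>?M\<^esub> B \<otimes>\<^bsub>?M\<^esub> A"
      by (auto simp: is_commutator_def)
    have entry: "U (i, j) \<in> gap_ring" if "U \<in> carrier ?M" "i < N" "j < N" for U i j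
      using matrix_entry[OF that] by simp
    have mult: "(U \<otimes>\<^bsub>?M\<^esub> Y) (i, j) = (\<Sum>k<N. U (i, k) * Y (k, j))"
      if "U \<in> carrier ?M" "Y \<in> carrier ?M" "i < N" "j < N" for U Y i j
      unfolding matrix_ring_entries(1)[OF that(3,4)] using that entry
      by (subst gap_ring.finsum_ring_on) (auto intro: gap_ring.closed(4))
    have comm: "C i j = (\<Sum>k<N. A (i, k) * B (k, j)) - (\<Sum>k<N. B (i, k) * A (k, j))"
      if ij: "i < N" "j < N" for i j
    proof -
      have "C i j = D (i, j)" using ij by (simp add: D_def)
      also have "\<dots> = (A \<otimes>\<^bsub>?M\<^esub> B) (i, j) \<ominus>\<^bsub>?R\<^esub> (B \<otimes>\<^bsub>?M\<^esub> A) (i, j)"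
        unfolding D using AB ij by (intro gap_ring.R.matrix_ring_minus_entries gap_ring.R.matrix_ring_closed)
      also have "\<dots> = (A \<otimes>\<^bsub>?M\<^esub> B) (i, j) - (B \<otimes>\<^bsub>?M\<^esub> A) (i, j)"
        using AB ij by (intro gap_ring.minus_ring_on entry gap_ring.R.matrix_ring_closed)
      finally show ?thesis using AB ij by (simp add: mult)
    qed
    show False
      by (rule not_commutator[OF N, of "\<lambda>i j. A (i, j)" "\<lambda>i j. B (i, j)" C])
         (use AB entry comm in \<open>auto simp: C_def y_def n_def\<close>)
  qed
  ultimately show "\<exists>C\<in>carrier ?M. matrix_trace ?R N C = \<zero>\<^bsub>?R\<^esub> \<and> \<not> is_commutator ?M C"
    using DM by blast
qed

end
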